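(* Let $(p_1,p_2,p_3)$ be a H\"older related triplet. Let $\psi\in L^\infty(\mathbb{R}^2)$ be $1$-periodic in both variables, i.e. $\psi(\xi,\eta)=\psi(\xi+1,\eta)=\psi(\xi,\eta+1)$. Then $\psi\in M_{p_1,p_2}^{p_3}(\mathbb{R})$ if and only if $\psi\in M_{p_1,p_2}^{p_3}(\mathbb{Z})$.
   Context: A triplet $(p_1,p_2,p_3)$ is H\"older related if $\frac1{p_1}+\frac1{p_2}=\frac1{p_3}$, where $p_1,p_2\ge 1$ and $p_3\ge \frac12$ (the value $\infty$ is allowed, with $1/\infty=0$). Fourier transforms: $\hat f(\xi)=\int_{\mathbb{R}} f(x)e^{-2\pi i x\xi}\,dx$ on $\mathbb{R}$, and $\hat a(\theta)=\sum_{k\in\mathbb{Z}}a_k e^{-2\pi i k\theta}$ for a sequence $a=(a_k)$ on $\mathbb{Z}$ with finitely many non-zero terms. Multipliers on $\mathbb{R}$: for $\psi\in L^\infty(\mathbb{R}^2)$ and Schwartz functions $f,g\in\mathcal{S}(\mathbb{R})$ put $C_\psi(f,g)(x)=\int_{\mathbb{R}}\int_{\mathbb{R}}\hat f(\xi)\hat g(\eta)\psi(\xi,\eta)e^{2\pi i x(\xi+\eta)}\,d\xi\,d\eta$. Then $\psi\in M_{p_1,p_2}^{p_3}(\mathbb{R})$ means that there is a constant $c$ with $\|C_\psi(f,g)\|_{L^{p_3}(\mathbb{R})}\le c\|f\|_{L^{p_1}(\mathbb{R})}\|g\|_{L^{p_2}(\mathbb{R})}$ for all $f,g\in\mathcal{S}(\mathbb{R})$.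 Multipliers on $\mathbb{Z}$: let $\mathbb{T}=\mathbb{R}/\mathbb{Z}$, and regard a bounded function $\psi$ that is $1$-periodic in both variables as a function on $\mathbb{T}^2$. For finitely supported sequences $a,b$ put $D_\psi(a,b)(l)=\int_{\mathbb{T}}\int_{\mathbb{T}}\hat a(\theta)\hat b(\rho)\psi(\theta,\rho)e^{2\pi i l(\theta+\rho)}\,d\theta\,d\rho$, $l\in\mathbb{Z}$. Then $\psi\in M_{p_1,p_2}^{p_3}(\mathbb{Z})$ means that there is a constant $c$ with $\|D_\psi(a,b)\|_{\ell^{p_3}(\mathbb{Z})}\le c\|a\|_{\ell^{p_1}(\mathbb{Z})}\|b\|_{\ell^{p_2}(\mathbb{Z})}$ for all finitely supported $a,b$. *)

theory Defs
  imports "HOL-Analysis.Analysis" "HOL-Probability.Essential_Supremum"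
begin

definition holder_related :: "ennreal \<Rightarrow> ennreal \<Rightarrow> ennreal \<Rightarrow> bool" where
  "holder_related p1 p2 p3 \<longleftrightarrow>
     1 \<le> p1 \<and> 1 \<le> p2 \<and> 1 / 2 \<le> p3 \<and> 1 / p1 + 1 / p2 = 1 / p3"

text \<open>The (quasi-)norm of \<open>L\<^sup>p\<close> for \<open>0 < p \<le> \<infinity>\<close>. The library has no \<open>powr\<close> on \<^typ>\<open>ennreal\<close>,
  so the \<open>1/p\<close>-th power of an infinite integral is treated separately.\<close>

definition Lp_norm :: "'a measure \<Rightarrow> ennreal \<Rightarrow> ('a \<Rightarrow> complex) \<Rightarrow> ennreal" where
  "Lp_norm M p f =
     (if p = \<infinity> then esssup M (\<lambda>x. ennreal (norm (f x)))
      else let I = \<integral>\<^sup>+ x. ennreal (norm (f x) powr enn2real p) \<partial>M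
           in if I = \<infinity> then \<infinity> else ennreal (enn2real I powr (1 / enn2real p)))"

abbreviation Lp_norm_real :: "ennreal \<Rightarrow> (real \<Rightarrow> complex) \<Rightarrow> ennreal" where
  "Lp_norm_real \<equiv> Lp_norm lborel"

abbreviation lp_norm_int :: "ennreal \<Rightarrow> (int \<Rightarrow> complex) \<Rightarrow> ennreal" where
  "lp_norm_int \<equiv> Lp_norm (count_space UNIV)"

text \<open>In the following definition \<open>D n\<close> is the \<open>n\<close>-th derivative of \<open>f\<close>.\<close>

definition schwartz :: "(real \<Rightarrow> complex) set" where
  "schwartz = {f. \<exists>D :: nat \<Rightarrow> real \<Rightarrow> complex. D 0 = f \<and>
     (\<forall>n x. (D n has_vector_derivative D (Suc n) x) (at x)) \<and>
     (\<forall>k n. \<exists>C. \<forall>x. \<bar>x\<bar> ^ k * norm (D n x) \<le> C)}"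

definition finsupp_seq :: "(int \<Rightarrow> complex) set" where
  "finsupp_seq = {a. finite {k. a k \<noteq> 0}}"

definition fourier_real :: "(real \<Rightarrow> complex) \<Rightarrow> real \<Rightarrow> complex" where
  "fourier_real f \<xi> = (\<integral>x. f x * cis (- 2 * pi * x * \<xi>) \<partial>lborel)"

definition fourier_int :: "(int \<Rightarrow> complex) \<Rightarrow> real \<Rightarrow> complex" where
  "fourier_int a \<theta> = (\<Sum>k\<in>{k. a k \<noteq> 0}. a k * cis (- 2 * pi * of_int k * \<theta>))"

text \<open>Elements of \<open>L\<^sup>\<infinity>(\<real>\<^sup>2)\<close> are represented by Lebesgue measurable, essentially bounded
  functions. Accordingly, periodicity is an identity of classes, that is, it holds almost
  everywhere.\<close>

definition Linfty_plane :: "(real \<times> real \<Rightarrow> complex) set" where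
  "Linfty_plane = {\<psi>. \<psi> \<in> borel_measurable lebesgue \<and>
     (\<exists>B. AE z in lebesgue. norm (\<psi> z) \<le> B)}"

definition periodic_plane :: "(real \<times> real \<Rightarrow> complex) \<Rightarrow> bool" where
  "periodic_plane \<psi> \<longleftrightarrow>
     (AE (\<xi>, \<eta>) in lebesgue. \<psi> (\<xi>, \<eta>) = \<psi> (\<xi> + 1, \<eta>) \<and> \<psi> (\<xi>, \<eta>) = \<psi> (\<xi>, \<eta> + 1))"

definition C_op ::
  "(real \<times> real \<Rightarrow> complex) \<Rightarrow> (real \<Rightarrow> complex) \<Rightarrow> (real \<Rightarrow> complex) \<Rightarrow> real \<Rightarrow> complex" where
  "C_op \<psi> f g x =
     (\<integral>(\<xi>, \<eta>). fourier_real f \<xi> * fourier_real g \<eta> * \<psi> (\<xi>, \<eta>) * cis (2 * pi * x * (\<xi> + \<eta>))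
        \<partial>lebesgue)"

text \<open>The torus \<open>\<real>/\<int>\<close> is represented by its fundamental domain \<open>[0,1)\<close>.\<close>

definition D_op ::
  "(real \<times> real \<Rightarrow> complex) \<Rightarrow> (int \<Rightarrow> complex) \<Rightarrow> (int \<Rightarrow> complex) \<Rightarrow> int \<Rightarrow> complex" where
  "D_op \<psi> a b l =
     set_lebesgue_integral lebesgue ({0..<1} \<times> {0..<1})
       (\<lambda>(\<theta>, \<rho>). fourier_int a \<theta> * fourier_int b \<rho> * \<psi> (\<theta>, \<rho>) *
          cis (2 * pi * of_int l * (\<theta> + \<rho>)))"

definition multipliers_real ::
  "ennreal \<Rightarrow> ennreal \<Rightarrow> ennreal \<Rightarrow> (real \<times> real \<Rightarrow> complex) set" where
  "multipliers_real p1 p2 p3 = {\<psi> \<in> Linfty_plane. \<exists>c::real. \<forall>f\<in>schwartz. \<forall>g\<in>schwartz.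
     Lp_norm_real p3 (C_op \<psi> f g) \<le> ennreal c * Lp_norm_real p1 f * Lp_norm_real p2 g}"

definition multipliers_int ::
  "ennreal \<Rightarrow> ennreal \<Rightarrow> ennreal \<Rightarrow> (real \<times> real \<Rightarrow> complex) set" where
  "multipliers_int p1 p2 p3 = {\<psi> \<in> Linfty_plane. periodic_plane \<psi> \<and>
     (\<exists>c::real. \<forall>a\<in>finsupp_seq. \<forall>b\<in>finsupp_seq.
       lp_norm_int p3 (D_op \<psi> a b) \<le> ennreal c * lp_norm_int p1 a * lp_norm_int p2 b)}"

end

theory Submission
  imports Defs "HOL-Probability.Sinc_Integral"
begin

text \<open>Why the theorem is true. Fix $y \in [0,1)$ and look at the values of $C_\psi(f,g)$ on the coset
$y + \mathbb{Z}$ only. Since $\psi$ is periodic, the integral over the plane that defines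
$C_\psi(f,g)(y+l)$ folds to an integral over the torus in which $\hat f$ and $\hat g$ are replaced by the
periodisations $\sum_m \hat f(\theta+m)\,e^{2\pi i (y+l)(\theta+m)}$. The Poisson summation formula turns
these into the Fourier series of the samples $j \mapsto f(y+j)$ and $j \mapsto g(y+j)$, up to the factor
$e^{2\pi i l\theta}$. Hence $C_\psi(f,g)(y+l) = D_\psi(f(y+\cdot),\,g(y+\cdot))(l)$: on every coset of
$\mathbb{Z}$ the operator on the line is the operator on the integers, applied to the samples
(lemma \<open>C_op_eq_D_series\<close>). Both implications follow from this identity.

From $\mathbb{Z}$ to $\mathbb{R}$: apply the bound for $D_\psi$ on every coset and integrate over $y$. The
$L^p(\mathbb{R})$ norm of a function is the $L^p([0,1))$ norm of the $\ell^p$ norms of its samples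
(\<open>eLp_tiling\<close>), and Hoelder's inequality on $[0,1)$ (\<open>eLp_holder\<close>) bounds the product of the
$\ell^{p_1}$ and $\ell^{p_2}$ norms that appears. The samples of a Schwartz function have infinite support in
general; they are reached from finitely supported sequences by truncation, dominated convergence and Fatou's
lemma (\<open>D_series_bound_extends\<close>).

From $\mathbb{R}$ to $\mathbb{Z}$: let $\varphi$ be a smooth bump that is positive on $(0,1)$ and zero
elsewhere, and test the bound on $f = \sum_k a_k \varphi(\cdot - k)$ and $g = \sum_k b_k \varphi(\cdot - k)$.
The samples of $f$ and $g$ at $y$ are $\varphi(y)\,a$ and $\varphi(y)\,b$, so that
$C_\psi(f,g)(y+l) = \varphi(y)^2 D_\psi(a,b)(l)$. All three norms split into a norm of the sequence and a norm
of a power of $\varphi$ that is neither zero nor infinite, and the latter go into the constant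
(\<open>D_series_bound_of_C_op_bound\<close>).

The Poisson formula is proved by Chernoff's argument: the difference between a periodisation $S$ and its value
at $0$ equals $q(t)\,(e^{2\pi i t}-1)$ with a bounded function $q$, so that the Fourier coefficients of $S$
telescope in those of $q$, which tend to zero by Bessel's inequality. The symbol, which is only Lebesgue measurable
and periodic almost everywhere, is first replaced by a Borel function that is bounded and periodic everywhere
(\<open>periodic_representative\<close>).\<close>

section \<open>Lebesgue norms of functions with values in the extended half line\<close>

text \<open>The real power on $[0,\infty]$; it is used for positive exponents, where sending $\infty$ to
$\infty$ makes it monotone and multiplicative.\<close>

definition epow :: "ennreal \<Rightarrow> real \<Rightarrow> ennreal" where
  "epow x p = (if x = \<infinity> then \<infinity> else ennreal (enn2real x powr p))"

lemma epow_ennreal: "0 \<le> x \<Longrightarrow> epow (ennreal x) p = ennreal (x powr p)"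
  by (simp add: epow_def)

lemma epow_top [simp]: "epow top p = top"
  by (simp add: epow_def)

lemma epow_0 [simp]: "epow 0 p = 0"
  by (simp add: epow_def)

lemma epow_mult: "p > 0 \<Longrightarrow> epow (x * y) p = epow x p * epow y p"
  by (cases x; cases y; cases "x = 0"; cases "y = 0")
     (auto simp: epow_ennreal ennreal_mult[symmetric] powr_mult ennreal_top_mult ennreal_mult_top)

lemma epow_epow: "epow (epow x p) q = epow x (p * q)"
  by (cases x) (auto simp: epow_ennreal powr_powr)

lemma epow_1 [simp]: "epow x 1 = x"
  by (cases x) (auto simp: epow_ennreal)

lemma epow_mono: "p > 0 \<Longrightarrow> x \<le> y \<Longrightarrow> epow x p \<le> epow y p"
  by (cases x; cases y) (auto simp: epow_ennreal powr_mono2 top_unique)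

lemma epow_le_iff: "p > 0 \<Longrightarrow> epow x p \<le> y \<longleftrightarrow> x \<le> epow y (1 / p)"
  using epow_mono[of p x "epow y (1/p)"] epow_mono[of "1/p" "epow x p" y]
  by (auto simp: epow_epow)

lemma epow_eq_0_iff [simp]: "epow x p = 0 \<longleftrightarrow> x = 0"
  by (cases x) (auto simp: epow_ennreal ennreal_eq_0_iff)

lemma epow_eq_top_iff [simp]: "epow x p = top \<longleftrightarrow> x = top"
  by (cases x) (auto simp: epow_ennreal)

lemma measurable_epow [measurable]:
  assumes [measurable]: "f \<in> borel_measurable M"
  shows "(\<lambda>x. epow (f x) p) \<in> borel_measurable M"
  unfolding epow_def by measurable

text \<open>The (quasi-)norm of $L^p$ for functions with values in $[0,\infty]$. Allowing the value $\infty$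
makes iterated norms, where the inner norm may be infinite on some fibres, meaningful without any finiteness
hypothesis.\<close>

definition eLp :: "'a measure \<Rightarrow> ennreal \<Rightarrow> ('a \<Rightarrow> ennreal) \<Rightarrow> ennreal" where
  "eLp M p F = (if p = \<infinity> then esssup M F
     else epow (\<integral>\<^sup>+ x. epow (F x) (enn2real p) \<partial>M) (1 / enn2real p))"

lemma Lp_norm_eq_eLp: "Lp_norm M p f = eLp M p (\<lambda>x. ennreal (norm (f x)))"
  unfolding Lp_norm_def eLp_def Let_def by (simp add: epow_ennreal epow_def[of "nn_integral _ _"])

lemma eLp_finite: "0 < r \<Longrightarrow> eLp M (ennreal r) F = epow (\<integral>\<^sup>+ x. epow (F x) r \<partial>M) (1 / r)"
  by (simp add: eLp_def)

lemma eLp_top: "eLp M top F = esssup M F"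
  by (simp add: eLp_def)

lemma eLp_finite_le_iff:
  "0 < r \<Longrightarrow> eLp M (ennreal r) F \<le> c \<longleftrightarrow> (\<integral>\<^sup>+ x. epow (F x) r \<partial>M) \<le> epow c r"
  by (simp add: eLp_finite epow_le_iff)

lemma eLp_top_le_iff:
  assumes "F \<in> borel_measurable M"
  shows "eLp M top F \<le> c \<longleftrightarrow> (AE x in M. F x \<le> c)"
proof
  assume "eLp M top F \<le> c"
  with esssup_AE[of F M] show "AE x in M. F x \<le> c"
    by (auto simp: eLp_top elim!: eventually_mono)
qed (use assms in \<open>auto simp: eLp_top\<close>)

lemma exponent_cases:
  assumes "(p::ennreal) > 0"
  obtains r where "0 < r" "p = ennreal r" | "p = top"
  using assms by (cases p) auto

lemma eLp_mono_AE:
  assumes "p > 0" "F \<in> borel_measurable M" "AE x in M. F x \<le> G x"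
  shows "eLp M p F \<le> eLp M p G"
  using \<open>p > 0\<close>
proof (cases rule: exponent_cases)
  case (1 r)
  have "(\<integral>\<^sup>+ x. epow (F x) r \<partial>M) \<le> (\<integral>\<^sup>+ x. epow (G x) r \<partial>M)"
    using assms(3) \<open>0 < r\<close> by (intro nn_integral_mono_AE) (auto intro: epow_mono elim: eventually_mono)
  with 1 show ?thesis by (auto simp: eLp_finite intro: epow_mono)
next
  case 2
  with assms show ?thesis by (auto simp: eLp_top intro: esssup_AE_mono)
qed

text \<open>The easy half of homogeneity, which already suffices for Hoelder's inequality; equality
is \<open>eLp_cmult\<close> below.\<close>

lemma eLp_cmult_le:
  assumes "p > 0" and [measurable]: "F \<in> borel_measurable M"
  shows "eLp M p (\<lambda>x. c * F x) \<le> c * eLp M p F"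
  using \<open>p > 0\<close>
proof (cases rule: exponent_cases)
  case (1 r)
  then show ?thesis
    by (simp add: eLp_finite epow_mult nn_integral_cmult epow_epow)
next
  case 2
  have "AE x in M. c * F x \<le> c * esssup M F"
    using esssup_AE[of F M] by (auto elim!: eventually_mono intro: mult_left_mono)
  with 2 show ?thesis by (auto simp: eLp_top)
qed

lemma eLp_count_space_top: "eLp (count_space UNIV) top F = (SUP j. F j)"
proof (rule antisym)
  show "eLp (count_space UNIV) top F \<le> (SUP j. F j)"
    by (subst eLp_top_le_iff) (auto intro: SUP_upper)
  show "(SUP j. F j) \<le> eLp (count_space UNIV) top F"
    using esssup_AE[of F "count_space UNIV"] by (auto simp: eLp_top AE_count_space intro!: SUP_least)
qed

lemma measurable_pair_countable2:
  fixes f :: "'a \<times> 'i::countable \<Rightarrow> 'b"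
  assumes "\<And>j. (\<lambda>x. f (x, j)) \<in> measurable M K"
  shows "f \<in> measurable (M \<Otimes>\<^sub>M count_space UNIV) K"
proof -
  have "(\<lambda>(j, x). f (x, j)) \<in> measurable (count_space UNIV \<Otimes>\<^sub>M M) K"
    using assms by (intro measurable_pair_measure_countable1) auto
  from measurable_compose[OF measurable_pair_swap' this] show ?thesis
    by (simp add: split_beta')
qed

lemma measurable_eLp_count_space:
  fixes F :: "'i::countable \<Rightarrow> 'a \<Rightarrow> ennreal"
  assumes "p > 0" and [measurable]: "\<And>j. F j \<in> borel_measurable M"
  shows "(\<lambda>y. eLp (count_space UNIV) p (\<lambda>j. F j y)) \<in> borel_measurable M"
  using \<open>p > 0\<close>
proof (cases rule: exponent_cases)
  case (1 r)
  interpret sigma_finite_measure "count_space (UNIV::'i set)"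
    by (rule sigma_finite_measure_count_space)
  have [measurable]: "(\<lambda>(y, j). epow (F j y) r) \<in> borel_measurable (M \<Otimes>\<^sub>M count_space UNIV)"
    by (rule measurable_pair_countable2) auto
  from 1 show ?thesis by (simp add: eLp_finite) measurable
next
  case 2
  then show ?thesis by (simp add: eLp_count_space_top)
qed

text \<open>Young's inequality. When a factor is infinite, the right-hand side is infinite
because both weights are positive.\<close>

lemma Youngs_inequality_epow:
  assumes "0 < s" "0 < t" "s + t = 1"
  shows "epow u s * epow v t \<le> ennreal s * u + ennreal t * v"
proof (cases "u = 0 \<or> v = 0 \<or> u = top \<or> v = top")
  case True
  with assms show ?thesis by (auto simp: ennreal_mult_top)
next
  case False
  then obtain a b where "u = ennreal a" "v = ennreal b" "0 < a" "0 < b"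
    by (cases u; cases v) auto
  with Youngs_inequality_0[of s t a b] assms show ?thesis
    by (simp add: epow_ennreal ennreal_mult[symmetric] ennreal_plus[symmetric] del: ennreal_plus)
qed

text \<open>Hoelder's inequality for the powers of two functions: after dividing
each function by its integral, apply Young's inequality pointwise and integrate. When an integral is $0$ the product
vanishes almost everywhere, and when one is infinite there is nothing to prove.\<close>

lemma nn_integral_epow_interpolation:
  assumes st: "0 < s" "0 < t" "s + t = 1"
    and [measurable]: "F \<in> borel_measurable M" "G \<in> borel_measurable M"
  shows "(\<integral>\<^sup>+ x. epow (F x) s * epow (G x) t \<partial>M) \<le> epow (\<integral>\<^sup>+ x. F x \<partial>M) s * epow (\<integral>\<^sup>+ x. G x \<partial>M) t"
proof -
  let ?A = "\<integral>\<^sup>+ x. F x \<partial>M" and ?B = "\<integral>\<^sup>+ x. G x \<partial>M"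
  consider "?A = 0" | "?B = 0" | "?A \<noteq> 0" "?B \<noteq> 0" "?A = top \<or> ?B = top"
    | "?A \<noteq> 0" "?B \<noteq> 0" "?A \<noteq> top" "?B \<noteq> top" by blast
  then show ?thesis
  proof cases
    case 1
    then have "AE x in M. epow (F x) s * epow (G x) t = 0"
      by (subst (asm) nn_integral_0_iff_AE) (auto elim!: eventually_mono)
    then have "(\<integral>\<^sup>+ x. epow (F x) s * epow (G x) t \<partial>M) = 0"
      by (subst nn_integral_0_iff_AE) auto
    then show ?thesis by simp
  next
    case 2
    then have "AE x in M. epow (F x) s * epow (G x) t = 0"
      by (subst (asm) nn_integral_0_iff_AE) (auto elim!: eventually_mono)
    then have "(\<integral>\<^sup>+ x. epow (F x) s * epow (G x) t \<partial>M) = 0"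
      by (subst nn_integral_0_iff_AE) auto
    then show ?thesis by simp
  next
    case 3
    then have "epow ?A s * epow ?B t = top"
      by (auto simp: ennreal_mult_eq_top_iff)
    then show ?thesis by simp
  next
    case 4
    have pointwise: "epow (F x) s * epow (G x) t
        \<le> epow ?A s * epow ?B t * (ennreal s * (F x / ?A) + ennreal t * (G x / ?B))" for x
    proof -
      have "epow (F x) s * epow (G x) t = epow (?A * (F x / ?A)) s * epow (?B * (G x / ?B)) t"
        using 4 by (simp add: ennreal_times_divide ennreal_mult_divide_eq mult.commute)
      also have "\<dots> = epow ?A s * epow ?B t * (epow (F x / ?A) s * epow (G x / ?B) t)"
        using st by (simp add: epow_mult mult_ac)
      also have "\<dots> \<le> epow ?A s * epow ?B t * (ennreal s * (F x / ?A) + ennreal t * (G x / ?B))"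
        by (intro mult_left_mono Youngs_inequality_epow st) auto
      finally show ?thesis .
    qed
    have "(\<integral>\<^sup>+ x. epow (F x) s * epow (G x) t \<partial>M)
        \<le> (\<integral>\<^sup>+ x. epow ?A s * epow ?B t * (ennreal s * (F x / ?A) + ennreal t * (G x / ?B)) \<partial>M)"
      by (intro nn_integral_mono pointwise)
    also have "\<dots> = epow ?A s * epow ?B t * (ennreal s * (?A / ?A) + ennreal t * (?B / ?B))"
      by (simp add: nn_integral_cmult nn_integral_add nn_integral_divide)
    also have "\<dots> = epow ?A s * epow ?B t"
      using 4 st by (simp add: ennreal_divide_self ennreal_plus[symmetric] less_top del: ennreal_plus)
    finally show ?thesis .
  qed
qed

lemma eLp_holder_top:
  assumes "p > 0" and [measurable]: "F \<in> borel_measurable M" "G \<in> borel_measurable M"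
  shows "eLp M p (\<lambda>x. F x * G x) \<le> eLp M top F * eLp M p G"
proof -
  have "AE x in M. F x * G x \<le> eLp M top F * G x"
    using esssup_AE[of F M] by (auto simp: eLp_top elim!: eventually_mono intro: mult_right_mono)
  then have "eLp M p (\<lambda>x. F x * G x) \<le> eLp M p (\<lambda>x. eLp M top F * G x)"
    using \<open>p > 0\<close> by (intro eLp_mono_AE) auto
  also have "\<dots> \<le> eLp M top F * eLp M p G"
    using \<open>p > 0\<close> by (intro eLp_cmult_le) auto
  finally show ?thesis .
qed

lemma inverse_top_eq_0: "inverse (top::ennreal) = 0"
  by simp

lemma inverse_inverse_ennreal: "inverse (inverse (x::ennreal)) = x"
  by (cases x rule: ennreal_cases; cases "x = 0") (auto simp: inverse_ennreal)

text \<open>If $p_1$ or $p_2$ is infinite this is \<open>eLp_holder_top\<close>. Otherwise, with $s = p_3/p_1$ and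
$t = p_3/p_2$ one has $s + t = 1$, and the claim is the interpolation inequality
for $F^{p_1}$ and $G^{p_2}$; in particular $p_3 < 1$ is covered.\<close>

lemma eLp_holder:
  assumes pos: "p1 > 0" "p2 > 0" "p3 > 0" and rel: "1 / p1 + 1 / p2 = 1 / p3"
    and [measurable]: "F \<in> borel_measurable M" "G \<in> borel_measurable M"
  shows "eLp M p3 (\<lambda>x. F x * G x) \<le> eLp M p1 F * eLp M p2 G"
proof -
  have rel': "inverse p1 + inverse p2 = inverse p3"
    using rel by (simp add: divide_ennreal_def)
  show ?thesis
  proof (cases rule: exponent_cases[OF \<open>p1 > 0\<close>])
    case 2
    then have "p3 = p2"
      using rel' inverse_inverse_ennreal by (metis add.left_neutral add.right_neutral inverse_top_eq_0)
    with 2 eLp_holder_top[of p2 F M G] pos show ?thesis by simp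
  next
    case r1: (1 r1)
    show ?thesis
    proof (cases rule: exponent_cases[OF \<open>p2 > 0\<close>])
      case 2
      then have "p3 = p1"
        using rel' inverse_inverse_ennreal by (metis add.left_neutral add.right_neutral inverse_top_eq_0)
      with 2 eLp_holder_top[of p1 G M F] pos show ?thesis by (simp add: mult.commute)
    next
      case r2: (1 r2)
      show ?thesis
      proof (cases rule: exponent_cases[OF \<open>p3 > 0\<close>])
        case 2
        with rel' r1 r2 show ?thesis by (simp add: inverse_ennreal)
      next
        case r3: (1 r3)
        have rr: "1 / r1 + 1 / r2 = 1 / r3"
          using rel' r1 r2 r3
          by (simp add: inverse_ennreal ennreal_plus[symmetric] inverse_eq_divide del: ennreal_plus)
        define s t where "s = r3 / r1" and "t = r3 / r2"
        have st: "0 < s" "0 < t" "s + t = 1"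
          using r1 r2 r3 arg_cong[OF rr, of "\<lambda>u. r3 * u"] by (auto simp: s_def t_def distrib_left)
        have [simp]: "r1 * s = r3" "r2 * t = r3"
          using r1 r2 by (auto simp: s_def t_def)
        have "(\<integral>\<^sup>+ x. epow (F x * G x) r3 \<partial>M)
            = (\<integral>\<^sup>+ x. epow (epow (F x) r1) s * epow (epow (G x) r2) t \<partial>M)"
          using r3 by (simp add: epow_mult epow_epow)
        also have "\<dots> \<le> epow (\<integral>\<^sup>+ x. epow (F x) r1 \<partial>M) s * epow (\<integral>\<^sup>+ x. epow (G x) r2 \<partial>M) t"
          by (intro nn_integral_epow_interpolation st) auto
        also have "\<dots> = epow (eLp M p1 F * eLp M p2 G) r3"
          using r1 r2 r3 by (simp add: eLp_finite epow_mult epow_epow s_def t_def)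
        finally show ?thesis
          using r3 by (simp add: eLp_finite_le_iff)
      qed
    qed
  qed
qed

text \<open>The factor \<open>c\<close> may be $0$ or $\infty$. For $p = \infty$ the two infinite cases have to be
separated: if $\infty\cdot F$ is essentially bounded by a finite number, then $F$ vanishes almost everywhere.\<close>

lemma eLp_cmult:
  assumes "p > 0" and [measurable]: "F \<in> borel_measurable M"
  shows "eLp M p (\<lambda>x. c * F x) = c * eLp M p F"
proof (rule antisym)
  show "c * eLp M p F \<le> eLp M p (\<lambda>x. c * F x)"
    using \<open>p > 0\<close>
  proof (cases rule: exponent_cases)
    case (1 r)
    then show ?thesis by (simp add: eLp_finite epow_mult nn_integral_cmult epow_epow)
  next
    case 2
    define e where "e = eLp M top (\<lambda>x. c * F x)"
    have ae: "AE x in M. c * F x \<le> e"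
      using eLp_top_le_iff[of "\<lambda>x. c * F x" M e] by (simp add: e_def)
    consider "c = 0" | "e = top" | "c = top" "e \<noteq> top" | "c \<noteq> 0" "c \<noteq> top" by blast
    then have "c * eLp M top F \<le> e"
    proof cases
      case 3
      have "AE x in M. F x \<le> 0"
        using ae by eventually_elim (use 3 in \<open>auto simp: ennreal_top_mult top_unique split: if_splits\<close>)
      then have "eLp M top F \<le> 0" by (subst eLp_top_le_iff) auto
      then show ?thesis by simp
    next
      case 4
      have "AE x in M. F x \<le> e / c"
        using ae
      proof eventually_elim
        case (elim x)
        then have "F x * c / c \<le> e / c"
          by (intro divide_right_mono_ennreal) (simp add: mult.commute)
        then show ?case using 4 by (simp add: ennreal_mult_divide_eq)
      qed
      then have "eLp M top F \<le> e / c" by (subst eLp_top_le_iff) auto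
      then have "c * eLp M top F \<le> c * (e / c)" by (intro mult_left_mono) auto
      also have "\<dots> = e" using 4 by (simp add: ennreal_times_divide ennreal_mult_divide_eq mult.commute[of c])
      finally show ?thesis .
    qed auto
    with 2 show ?thesis by (simp add: e_def)
  qed
qed (rule eLp_cmult_le[OF assms])

lemma eLp_eq_0_imp_AE:
  assumes "p > 0" and [measurable]: "F \<in> borel_measurable M" and "eLp M p F = 0"
  shows "AE x in M. F x = 0"
  using \<open>p > 0\<close>
proof (cases rule: exponent_cases)
  case (1 r)
  with assms(3) have "(\<integral>\<^sup>+ x. epow (F x) r \<partial>M) = 0" by (simp add: eLp_finite)
  then show ?thesis by (subst (asm) nn_integral_0_iff_AE) auto
next
  case 2
  with assms(3) eLp_top_le_iff[of F M 0] show ?thesis by simp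
qed

lemma eLp_prob_le:
  assumes "p > 0" "emeasure M (space M) \<le> 1" and [measurable]: "F \<in> borel_measurable M" and le: "\<And>x. F x \<le> 1"
  shows "eLp M p F \<le> 1"
  using \<open>p > 0\<close>
proof (cases rule: exponent_cases)
  case (1 r)
  have "(\<integral>\<^sup>+ x. epow (F x) r \<partial>M) \<le> (\<integral>\<^sup>+ x. 1 \<partial>M)"
    using epow_mono[OF 1(1) le] epow_ennreal[of 1 r] by (intro nn_integral_mono) simp
  with assms(2) 1 epow_ennreal[of 1 r] show ?thesis by (simp add: eLp_finite_le_iff)
next
  case 2
  then show ?thesis using le by (auto simp: eLp_top_le_iff)
qed

text \<open>Lower semicontinuity of the $\ell^p$ norm under pointwise convergence: Fatou's
lemma for finite $p$.\<close>

lemma eLp_count_space_le_limit: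
  fixes u :: "nat \<Rightarrow> 'i \<Rightarrow> complex"
  assumes "p > 0" and lim: "\<And>i. (\<lambda>N. u N i) \<longlonglongrightarrow> v i"
    and le: "\<And>N. eLp (count_space UNIV) p (\<lambda>i. ennreal (norm (u N i))) \<le> R"
  shows "eLp (count_space UNIV) p (\<lambda>i. ennreal (norm (v i))) \<le> R"
  using \<open>p > 0\<close>
proof (cases rule: exponent_cases)
  case (1 r)
  have "(\<lambda>N. epow (ennreal (norm (u N i))) r) \<longlonglongrightarrow> epow (ennreal (norm (v i))) r" for i
    using 1 by (simp add: epow_ennreal) (intro tendsto_ennrealI tendsto_powr' tendsto_norm lim tendsto_const; simp)
  then have "epow (ennreal (norm (v i))) r = liminf (\<lambda>N. epow (ennreal (norm (u N i))) r)" for i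
    by (intro lim_imp_Liminf[symmetric]) auto
  then have "(\<integral>\<^sup>+ i. epow (ennreal (norm (v i))) r \<partial>count_space UNIV)
      = (\<integral>\<^sup>+ i. liminf (\<lambda>N. epow (ennreal (norm (u N i))) r) \<partial>count_space UNIV)" by simp
  also have "\<dots> \<le> liminf (\<lambda>N. \<integral>\<^sup>+ i. epow (ennreal (norm (u N i))) r \<partial>count_space UNIV)"
    by (rule nn_integral_liminf) simp
  also have "\<dots> \<le> epow R r"
    using le 1 by (intro Liminf_le) (auto simp: eLp_finite_le_iff)
  finally show ?thesis using 1 by (simp add: eLp_finite_le_iff)
next
  case 2
  have "ennreal (norm (v i)) \<le> R" for i
  proof (rule LIMSEQ_le_const2)
    show "(\<lambda>N. ennreal (norm (u N i))) \<longlonglongrightarrow> ennreal (norm (v i))"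
      by (intro tendsto_ennrealI tendsto_norm lim)
    have "ennreal (norm (u N i)) \<le> R" for N
      using le[of N] 2 by (simp add: eLp_count_space_top SUP_le_iff)
    then show "\<exists>N. \<forall>n\<ge>N. ennreal (norm (u n i)) \<le> R" by blast
  qed
  with 2 show ?thesis by (simp add: eLp_count_space_top SUP_le_iff)
qed

section \<open>Integrals over a space tiled by translates of a cell\<close>

text \<open>The translates of the cell \<open>Q\<close> by the vectors \<open>\<tau> k\<close> partition the space.\<close>

definition tiling :: "('i::countable \<Rightarrow> 'a::euclidean_space) \<Rightarrow> 'a set \<Rightarrow> bool" where
  "tiling \<tau> Q \<longleftrightarrow> Q \<in> sets borel \<and> (\<forall>x. \<exists>!k. x - \<tau> k \<in> Q)"

abbreviation cell :: "'a::euclidean_space set \<Rightarrow> 'a measure" where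
  "cell Q \<equiv> restrict_space lborel Q"

lemma nn_integral_lborel_translate:
  fixes f :: "'a::euclidean_space \<Rightarrow> ennreal"
  assumes [measurable]: "f \<in> borel_measurable borel"
  shows "(\<integral>\<^sup>+ x. f (x + t) \<partial>lborel) = (\<integral>\<^sup>+ x. f x \<partial>lborel)"
  by (subst (2) lborel_distr_plus[of t, symmetric]) (simp add: nn_integral_distr add.commute)

lemma integral_lborel_translate:
  fixes f :: "'a::euclidean_space \<Rightarrow> 'b::{banach, second_countable_topology}"
  assumes [measurable]: "f \<in> borel_measurable borel"
  shows "(\<integral> x. f (x + t) \<partial>lborel) = (\<integral> x. f x \<partial>lborel)"
  by (subst (2) lborel_distr_plus[of t, symmetric]) (simp add: integral_distr add.commute)

lemma AE_lborel_translate: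
  fixes t :: "'a::euclidean_space"
  assumes "AE z in lborel. P z" shows "AE z in lborel. P (z + t)"
proof -
  have "AE z in distr lborel borel ((+) t). P z"
    using assms unfolding lborel_distr_plus .
  then have "AE z in lborel. P (t + z)"
    by (rule AE_distrD[rotated]) simp
  then show ?thesis by (simp add: add.commute)
qed

lemma sigma_finite_cell: "Q \<in> sets borel \<Longrightarrow> sigma_finite_measure (cell Q)"
  by (rule sigma_finite_measure_restrict_space) (auto intro: sigma_finite_lborel)

lemma pair_sigma_finite_cell:
  "Q \<in> sets borel \<Longrightarrow> pair_sigma_finite (cell Q) (count_space (UNIV :: 'i::countable set))"
  by (intro pair_sigma_finite.intro sigma_finite_cell sigma_finite_measure_count_space)

lemma measurable_cell_shift:
  fixes f :: "'a::euclidean_space \<Rightarrow> 'b::topological_space"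
  assumes [measurable]: "f \<in> borel_measurable borel"
  shows "(\<lambda>z. f (z + t)) \<in> borel_measurable (cell Q)"
  by (rule measurable_restrict_space1) measurable

lemma measurable_tiling_map:
  fixes \<tau> :: "'i::countable \<Rightarrow> 'a::euclidean_space"
  shows "(\<lambda>(z, k). z + \<tau> k) \<in> measurable (cell Q \<Otimes>\<^sub>M count_space UNIV) borel"
  by (rule measurable_pair_countable2) (simp add: measurable_restrict_space1)

text \<open>The product of Lebesgue measure on a cell with the counting measure on the translations is
mapped to Lebesgue measure on the whole space. All folding formulas below are this identity combined with
Fubini's theorem.\<close>

lemma distr_tiling:
  fixes \<tau> :: "'i::countable \<Rightarrow> 'a::euclidean_space"
  assumes "tiling \<tau> Q"
  shows "distr (cell Q \<Otimes>\<^sub>M count_space UNIV) borel (\<lambda>(z, k). z + \<tau> k) = lborel"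
proof (rule measure_eqI)
  fix A assume "A \<in> sets (distr (cell Q \<Otimes>\<^sub>M count_space UNIV) borel (\<lambda>(z, k). z + \<tau> k))"
  then have A[measurable]: "A \<in> sets borel" by simp
  have Q[measurable]: "Q \<in> sets borel" and uniq: "\<And>x. \<exists>!k. x - \<tau> k \<in> Q"
    using assms by (auto simp: tiling_def)
  interpret P: pair_sigma_finite "cell Q" "count_space (UNIV :: 'i set)"
    by (rule pair_sigma_finite_cell) (rule Q)
  note [measurable] = measurable_tiling_map[of \<tau> Q]
  \<comment> \<open>Exactly one translate of the cell contains \<open>x\<close>.\<close>
  have one: "(\<integral>\<^sup>+ k. indicator Q (x - \<tau> k) \<partial>count_space UNIV) = (1::ennreal)" for x
  proof -
    obtain k0 where k0: "\<And>k. x - \<tau> k \<in> Q \<longleftrightarrow> k = k0"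
      using uniq[of x] by metis
    have "(\<integral>\<^sup>+ k. indicator Q (x - \<tau> k) \<partial>count_space UNIV)
        = (\<integral>\<^sup>+ k. indicator {k0} k \<partial>count_space UNIV)"
      by (rule nn_integral_cong) (simp add: indicator_def k0)
    also have "\<dots> = 1" by (subst nn_integral_indicator) auto
    finally show ?thesis .
  qed
  have "emeasure (distr (cell Q \<Otimes>\<^sub>M count_space UNIV) borel (\<lambda>(z, k). z + \<tau> k)) A
      = (\<integral>\<^sup>+ x. indicator A x \<partial>distr (cell Q \<Otimes>\<^sub>M count_space UNIV) borel (\<lambda>(z, k). z + \<tau> k))"
    by simp
  also have "\<dots> = (\<integral>\<^sup>+ w. indicator A ((\<lambda>(z, k). z + \<tau> k) w) \<partial>(cell Q \<Otimes>\<^sub>M count_space UNIV))"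
    by (rule nn_integral_distr) auto
  also have "\<dots> = (\<integral>\<^sup>+ k. \<integral>\<^sup>+ z. indicator A (z + \<tau> k) \<partial>cell Q \<partial>count_space UNIV)"
    by (subst P.nn_integral_snd[symmetric]) auto
  also have "\<dots> = (\<integral>\<^sup>+ k. \<integral>\<^sup>+ x. indicator A x * indicator Q (x - \<tau> k) \<partial>lborel \<partial>count_space UNIV)"
  proof (rule nn_integral_cong)
    fix k :: 'i
    have "(\<integral>\<^sup>+ z. indicator A (z + \<tau> k) \<partial>cell Q)
        = (\<integral>\<^sup>+ z. indicator A (z + \<tau> k) * indicator Q (z + \<tau> k - \<tau> k) \<partial>lborel)"
      by (subst nn_integral_restrict_space) auto
    also have "\<dots> = (\<integral>\<^sup>+ x. indicator A x * indicator Q (x - \<tau> k) \<partial>lborel)"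
      by (rule nn_integral_lborel_translate[where f = "\<lambda>x. indicator A x * indicator Q (x - \<tau> k)"]) measurable
    finally show "(\<integral>\<^sup>+ z. indicator A (z + \<tau> k) \<partial>cell Q) = \<dots>" .
  qed
  also have "\<dots> = (\<integral>\<^sup>+ x. \<integral>\<^sup>+ k. indicator A x * indicator Q (x - \<tau> k) \<partial>count_space UNIV \<partial>lborel)"
    by (rule nn_integral_count_space_nn_integral[symmetric]) auto
  also have "\<dots> = emeasure lborel A"
    by (simp add: nn_integral_cmult one)
  finally show "emeasure (distr (cell Q \<Otimes>\<^sub>M count_space UNIV) borel (\<lambda>(z, k). z + \<tau> k)) A = emeasure lborel A" .
qed simp

lemma nn_integral_tiling:
  fixes \<tau> :: "'i::countable \<Rightarrow> 'a::euclidean_space"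
  assumes "tiling \<tau> Q" and [measurable]: "F \<in> borel_measurable borel"
  shows "(\<integral>\<^sup>+ x. F x \<partial>lborel) = (\<integral>\<^sup>+ z. \<integral>\<^sup>+ k. F (z + \<tau> k) \<partial>count_space UNIV \<partial>cell Q)"
proof -
  interpret P: pair_sigma_finite "cell Q" "count_space (UNIV :: 'i set)"
    using assms(1) by (intro pair_sigma_finite_cell) (simp add: tiling_def)
  note [measurable] = measurable_tiling_map[of \<tau> Q]
  show ?thesis
    by (subst distr_tiling[OF assms(1), symmetric], subst nn_integral_distr)
       (auto simp: split_beta' P.M2.nn_integral_fst[where f = "\<lambda>w. F (fst w + \<tau> (snd w))", symmetric, simplified])
qed

lemma integrable_tiling:
  fixes \<tau> :: "'i::countable \<Rightarrow> 'a::euclidean_space"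
    and F :: "'a \<Rightarrow> 'b::{banach, second_countable_topology}"
  assumes "tiling \<tau> Q" "integrable lborel F"
  shows "integrable (cell Q \<Otimes>\<^sub>M count_space UNIV) (\<lambda>(z, k). F (z + \<tau> k))"
proof -
  have "integrable (distr (cell Q \<Otimes>\<^sub>M count_space UNIV) borel (\<lambda>(z, k). z + \<tau> k)) F"
    using assms by (simp add: distr_tiling)
  from integrable_distr[OF measurable_tiling_map this] show ?thesis
    by (simp add: split_beta')
qed

lemma integral_tiling:
  fixes \<tau> :: "'i::countable \<Rightarrow> 'a::euclidean_space"
    and F :: "'a \<Rightarrow> 'b::{banach, second_countable_topology}"
  assumes "tiling \<tau> Q" "integrable lborel F"
  shows "(\<integral> x. F x \<partial>lborel) = (\<integral> z. \<integral> k. F (z + \<tau> k) \<partial>count_space UNIV \<partial>cell Q)"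
proof -
  interpret P: pair_sigma_finite "cell Q" "count_space (UNIV :: 'i set)"
    using assms(1) by (intro pair_sigma_finite_cell) (simp add: tiling_def)
  have [measurable]: "F \<in> borel_measurable borel" using assms(2) by auto
  have "(\<integral> x. F x \<partial>lborel) = (\<integral> w. F (case w of (z, k) \<Rightarrow> z + \<tau> k) \<partial>(cell Q \<Otimes>\<^sub>M count_space UNIV))"
    by (subst distr_tiling[OF assms(1), symmetric], rule integral_distr[OF measurable_tiling_map]) simp
  also have "\<dots> = (\<integral> z. \<integral> k. F (z + \<tau> k) \<partial>count_space UNIV \<partial>cell Q)"
    using P.integral_fst'[OF integrable_tiling[OF assms]] by (simp add: split_beta')
  finally show ?thesis .
qed

text \<open>For $p = \infty$ the identity says that a bound holds almost everywhere exactly if, for almost every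
point of the cell, it holds at all translates of that point.\<close>

lemma eLp_tiling:
  fixes \<tau> :: "'i::countable \<Rightarrow> 'a::euclidean_space"
  assumes "tiling \<tau> Q" "p > 0" and [measurable]: "F \<in> borel_measurable borel"
  shows "eLp lborel p F = eLp (cell Q) p (\<lambda>z. eLp (count_space UNIV) p (\<lambda>k. F (z + \<tau> k)))"
  using \<open>p > 0\<close>
proof (cases rule: exponent_cases)
  case (1 r)
  then show ?thesis
    by (simp add: eLp_finite epow_epow nn_integral_tiling[OF assms(1)])
next
  case 2
  interpret P: pair_sigma_finite "cell Q" "count_space (UNIV :: 'i set)"
    using assms(1) by (intro pair_sigma_finite_cell) (simp add: tiling_def)
  note [measurable] = measurable_tiling_map[of \<tau> Q] measurable_cell_shift
  let ?G = "\<lambda>z. eLp (count_space UNIV) top (\<lambda>k. F (z + \<tau> k))"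
  have [measurable]: "?G \<in> borel_measurable (cell Q)"
    by (intro measurable_eLp_count_space) (auto intro: measurable_cell_shift)
  have "eLp lborel top F \<le> c \<longleftrightarrow> eLp (cell Q) top ?G \<le> c" for c
  proof -
    have "eLp lborel top F \<le> c \<longleftrightarrow> (AE x in lborel. F x \<le> c)"
      by (rule eLp_top_le_iff) simp
    also have "\<dots> \<longleftrightarrow> (AE w in cell Q \<Otimes>\<^sub>M count_space UNIV. F (case w of (z, k) \<Rightarrow> z + \<tau> k) \<le> c)"
      by (subst distr_tiling[OF assms(1), symmetric], rule AE_distr_iff) auto
    also have "\<dots> \<longleftrightarrow> (AE z in cell Q. AE k in count_space UNIV. F (z + \<tau> k) \<le> c)"
    proof -
      have [measurable]: "(\<lambda>w. fst w + \<tau> (snd w)) \<in> measurable (cell Q \<Otimes>\<^sub>M count_space UNIV) borel"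
        using measurable_tiling_map[of \<tau> Q] by (simp add: split_beta')
      have "(AE z in cell Q. AE k in count_space UNIV. F (z + \<tau> k) \<le> c)
          \<longleftrightarrow> (AE w in cell Q \<Otimes>\<^sub>M count_space UNIV. F (fst w + \<tau> (snd w)) \<le> c)"
        by (rule P.AE_pair_iff) measurable
      then show ?thesis by (simp add: split_beta')
    qed
    also have "\<dots> \<longleftrightarrow> (AE z in cell Q. ?G z \<le> c)"
      by (simp add: AE_count_space eLp_count_space_top SUP_le_iff)
    also have "\<dots> \<longleftrightarrow> eLp (cell Q) top ?G \<le> c"
      by (rule eLp_top_le_iff[symmetric]) simp
    finally show ?thesis .
  qed
  with 2 show ?thesis by (metis antisym order_refl)
qed

lemma ex1_floor:
  fixes a x :: real
  shows "\<exists>!k::int. x - of_int k \<in> {a..<a + 1}"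
proof (rule ex1I[of _ "\<lfloor>x - a\<rfloor>"])
  show "x - of_int \<lfloor>x - a\<rfloor> \<in> {a..<a + 1}"
    by simp linarith
qed (auto intro!: floor_unique[symmetric])

lemma tiling_real: "tiling (of_int :: int \<Rightarrow> real) {a..<a + 1}"
  unfolding tiling_def using ex1_floor[of _ a] by simp

abbreviation lattice_point :: "int \<times> int \<Rightarrow> real \<times> real" where
  "lattice_point mn \<equiv> (of_int (fst mn), of_int (snd mn))"

lemma tiling_plane: "tiling lattice_point ({a..<a + 1} \<times> {b..<b + 1})"
  unfolding tiling_def
proof (intro conjI allI)
  show "{a..<a + 1} \<times> {b..<b + 1} \<in> sets borel"
    by (simp add: borel_prod[symmetric] del: borel_prod)
  fix x :: "real \<times> real"
  obtain m where m: "fst x - of_int m \<in> {a..<a + 1}" "\<And>m'. fst x - of_int m' \<in> {a..<a + 1} \<Longrightarrow> m' = m"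
    using ex1_floor[of "fst x" a] by blast
  obtain n where n: "snd x - of_int n \<in> {b..<b + 1}" "\<And>n'. snd x - of_int n' \<in> {b..<b + 1} \<Longrightarrow> n' = n"
    using ex1_floor[of "snd x" b] by blast
  show "\<exists>!k. x - lattice_point k \<in> {a..<a + 1} \<times> {b..<b + 1}"
  proof (rule ex1I[of _ "(m, n)"])
    show "x - lattice_point (m, n) \<in> {a..<a + 1} \<times> {b..<b + 1}"
      using m(1) n(1) by (simp add: mem_Times_iff)
    fix k assume "x - lattice_point k \<in> {a..<a + 1} \<times> {b..<b + 1}"
    with m(2)[of "fst k"] n(2)[of "snd k"] show "k = (m, n)"
      by (simp add: mem_Times_iff prod_eq_iff)
  qed
qed

lemma measurable_fst_plane [measurable]: "fst \<in> borel_measurable (borel :: (real \<times> real) measure)"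
  and measurable_snd_plane [measurable]: "snd \<in> borel_measurable (borel :: (real \<times> real) measure)"
  by (simp_all add: borel_measurable_continuous_onI continuous_on_fst continuous_on_snd continuous_on_id)

lemma integrable_product:
  fixes u :: "'a \<Rightarrow> complex" and v :: "'b \<Rightarrow> complex"
  assumes "pair_sigma_finite M1 M2" and u: "integrable M1 u" and v: "integrable M2 v"
  shows "integrable (M1 \<Otimes>\<^sub>M M2) (\<lambda>w. u (fst w) * v (snd w))"
proof -
  interpret pair_sigma_finite M1 M2 by fact
  have [measurable]: "u \<in> borel_measurable M1" "v \<in> borel_measurable M2" using u v by auto
  show ?thesis
    using u v by (intro Fubini_integrable) (auto simp: norm_mult)
qed

text \<open>Fubini's theorem for a product of two absolutely convergent series; sums are
written as integrals with respect to the counting measure so that the convergence theorems of integration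
apply to them.\<close>

lemma integral_count_space_product:
  fixes u :: "'i::countable \<Rightarrow> complex" and v :: "'j::countable \<Rightarrow> complex"
  assumes u: "integrable (count_space UNIV) u" and v: "integrable (count_space UNIV) v"
  shows "(\<integral>w. u (fst w) * v (snd w) \<partial>count_space UNIV)
       = (\<integral>i. u i \<partial>count_space UNIV) * (\<integral>j. v j \<partial>count_space UNIV)"
proof -
  interpret pair_sigma_finite "count_space (UNIV :: 'i set)" "count_space (UNIV :: 'j set)"
    by (intro pair_sigma_finite.intro sigma_finite_measure_count_space)
  have "count_space (UNIV :: ('i \<times> 'j) set) = count_space UNIV \<Otimes>\<^sub>M count_space UNIV"
    by (subst pair_measure_countable) auto
  then show ?thesis
    using integral_fst'[OF integrable_product[OF pair_sigma_finite_axioms u v]] by simp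
qed

section \<open>Quadratic decay and the Fourier transform\<close>

text \<open>The weight that dominates all functions below. It is integrable on the line and
summable on the integers, and translations change it by a bounded factor only.\<close>

definition inv_quadratic :: "real \<Rightarrow> real" where "inv_quadratic x = 1 / (1 + x\<^sup>2)"

lemma inv_quadratic_pos: "0 < inv_quadratic x"
  by (simp add: inv_quadratic_def add_pos_nonneg)

lemma inv_quadratic_nonneg [simp]: "0 \<le> inv_quadratic x"
  using inv_quadratic_pos[of x] by simp

lemma inv_quadratic_measurable [measurable]: "inv_quadratic \<in> borel_measurable borel"
  unfolding inv_quadratic_def by measurable

lemma inv_quadratic_shift: "inv_quadratic (x + t) \<le> 2 * (1 + x\<^sup>2) * inv_quadratic t"
proof -
  \<comment> \<open>The difference of the two sides of the next inequality is this sum of squares.\<close>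
  have "0 \<le> (2 * x + t)\<^sup>2 + 2 * (x * (x + t))\<^sup>2 + 1" by simp
  then have "1 + t\<^sup>2 \<le> 2 * (1 + x\<^sup>2) * (1 + (x + t)\<^sup>2)"
    by (simp add: power2_eq_square algebra_simps)
  then show ?thesis
    unfolding inv_quadratic_def by (simp add: divide_simps add_pos_nonneg sum_power2_gt_zero_iff)
qed

lemma inv_quadratic_shift_unit:
  assumes "\<bar>x\<bar> \<le> 1" shows "inv_quadratic (x + t) \<le> 4 * inv_quadratic t"
proof -
  have "x\<^sup>2 \<le> 1" using assms by (simp add: abs_square_le_1)
  then have "2 * (1 + x\<^sup>2) * inv_quadratic t \<le> 4 * inv_quadratic t"
    by (intro mult_right_mono) auto
  with inv_quadratic_shift[of x t] show ?thesis by linarith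
qed

lemma integrable_inv_quadratic: "integrable lborel inv_quadratic"
  using integrable_inverse_1_plus_square
  by (simp add: set_integrable_def einterval_def inv_quadratic_def[abs_def] inverse_eq_divide)

text \<open>Comparison with the integral over the line: on $[k, k+1)$ the weight is at least
a quarter of its value at $k$.\<close>

lemma integrable_inv_quadratic_int: "integrable (count_space UNIV) (\<lambda>k::int. inv_quadratic (real_of_int k))"
proof (rule integrableI_bounded)
  have "(\<integral>\<^sup>+ k. ennreal (inv_quadratic (real_of_int k)) \<partial>count_space UNIV)
      = (\<integral>\<^sup>+ z. \<integral>\<^sup>+ k. ennreal (inv_quadratic (real_of_int k)) \<partial>count_space UNIV \<partial>cell {0::real..<0+1})"
    by (simp add: emeasure_restrict_space)
  also have "\<dots> \<le> (\<integral>\<^sup>+ z. \<integral>\<^sup>+ k. ennreal (4 * inv_quadratic (z + real_of_int k)) \<partial>count_space UNIV \<partial>cell {0::real..<0+1})"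
  proof (intro nn_integral_mono ennreal_leI)
    fix z :: real and k :: int assume "z \<in> space (cell {0..<0+1})"
    then show "inv_quadratic (real_of_int k) \<le> 4 * inv_quadratic (z + of_int k)"
      using inv_quadratic_shift_unit[of "-z" "z + of_int k"] by simp
  qed
  also have "\<dots> = (\<integral>\<^sup>+ x. ennreal (4 * inv_quadratic x) \<partial>lborel)"
    by (rule nn_integral_tiling[OF tiling_real, symmetric]) measurable
  also have "\<dots> < \<infinity>"
    using integrable_inv_quadratic by (subst nn_integral_eq_integral) auto
  finally show "(\<integral>\<^sup>+ k. ennreal (norm (inv_quadratic (real_of_int k))) \<partial>count_space UNIV) < \<infinity>"
    by simp
qed simp

definition quadratic_decay :: "(real \<Rightarrow> complex) \<Rightarrow> bool" where
  "quadratic_decay f \<longleftrightarrow> (\<exists>C\<ge>0. \<forall>t. norm (f t) \<le> C * inv_quadratic t)"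

lemma quadratic_decay_integrable:
  assumes "quadratic_decay f" "f \<in> borel_measurable borel" shows "integrable lborel f"
proof -
  obtain C where C: "\<And>t. norm (f t) \<le> C * inv_quadratic t" using assms(1) by (auto simp: quadratic_decay_def)
  show ?thesis
    by (rule Bochner_Integration.integrable_bound[of _ "\<lambda>t. C * inv_quadratic t"])
       (use assms C integrable_inv_quadratic in \<open>auto intro!: AE_I2 order.trans[OF C]\<close>)
qed

lemma quadratic_decay_shift_bound:
  assumes "quadratic_decay f" shows "\<exists>C\<ge>0. \<forall>t. norm (f (x + t)) \<le> C * inv_quadratic t"
proof -
  obtain C where C: "0 \<le> C" "\<And>t. norm (f t) \<le> C * inv_quadratic t" using assms(1) by (auto simp: quadratic_decay_def)
  show ?thesis
  proof (intro exI conjI allI)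
    fix t
    have "C * inv_quadratic (x + t) \<le> C * (2 * (1 + x\<^sup>2) * inv_quadratic t)"
      by (intro mult_left_mono inv_quadratic_shift C)
    with C(2)[of "x + t"] show "norm (f (x + t)) \<le> C * (2 * (1 + x\<^sup>2)) * inv_quadratic t"
      by (simp add: mult_ac)
  qed (use C in auto)
qed

lemma quadratic_decay_integrable_int:
  assumes "quadratic_decay f"
  shows "integrable (count_space UNIV) (\<lambda>k::int. f (x + of_int k))"
proof -
  obtain C where C: "0 \<le> C" "\<And>t. norm (f (x + t)) \<le> C * inv_quadratic t"
    using quadratic_decay_shift_bound[OF assms] by blast
  show ?thesis
    by (rule Bochner_Integration.integrable_bound[of _ "\<lambda>k::int. C * inv_quadratic (real_of_int k)"])
       (use C integrable_inv_quadratic_int in \<open>auto intro!: AE_I2 order.trans[OF C(2)]\<close>)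
qed

lemma inv_quadratic_tendsto: "(\<lambda>n. inv_quadratic (real n)) \<longlonglongrightarrow> 0" "(\<lambda>n. inv_quadratic (- real n)) \<longlonglongrightarrow> 0"
proof -
  show "(\<lambda>n. inv_quadratic (real n)) \<longlonglongrightarrow> 0"
  proof (rule Lim_null_comparison[OF always_eventually LIMSEQ_inverse_real_of_nat], rule allI)
    fix n :: nat
    have "real n \<le> (real n)\<^sup>2" by (cases n) (auto simp: power2_eq_square)
    then show "norm (inv_quadratic (real n)) \<le> inverse (real (Suc n))"
      by (simp add: inv_quadratic_def inverse_eq_divide) (intro divide_left_mono; simp add: add_pos_nonneg)
  qed
  then show "(\<lambda>n. inv_quadratic (- real n)) \<longlonglongrightarrow> 0"
    by (simp add: inv_quadratic_def)
qed

lemma quadratic_decay_tendsto: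
  assumes "quadratic_decay f"
  shows "(\<lambda>n. f (real n)) \<longlonglongrightarrow> 0" "(\<lambda>n. f (- real n)) \<longlonglongrightarrow> 0"
proof -
  obtain C where C: "\<And>t. norm (f t) \<le> C * inv_quadratic t" using assms(1) by (auto simp: quadratic_decay_def)
  have lim: "(\<lambda>n. C * inv_quadratic (real n)) \<longlonglongrightarrow> 0" "(\<lambda>n. C * inv_quadratic (- real n)) \<longlonglongrightarrow> 0"
    using inv_quadratic_tendsto by (auto intro!: tendsto_mult_right_zero)
  show "(\<lambda>n. f (real n)) \<longlonglongrightarrow> 0"
    by (rule Lim_null_comparison[OF always_eventually lim(1)]) (simp add: C)
  show "(\<lambda>n. f (- real n)) \<longlonglongrightarrow> 0"
    by (rule Lim_null_comparison[OF always_eventually lim(2)]) (simp add: C)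
qed

text \<open>The fundamental theorem of calculus on $[-n,n]$, with \<open>n\<close> tending to infinity.\<close>

lemma integral_deriv_eq_0:
  fixes g g' :: "real \<Rightarrow> complex"
  assumes der: "\<And>x. (g has_vector_derivative g' x) (at x)"
    and cont: "continuous_on UNIV g'"
    and "quadratic_decay g" "quadratic_decay g'"
  shows "(\<integral>x. g' x \<partial>lborel) = 0"
proof -
  have [measurable]: "g' \<in> borel_measurable borel"
    using cont by (rule borel_measurable_continuous_onI)
  have int: "integrable lborel g'"
    using \<open>quadratic_decay g'\<close> by (rule quadratic_decay_integrable) measurable
  have "(\<lambda>n. \<integral>x. indicator {- real n..real n} x *\<^sub>R g' x \<partial>lborel) \<longlonglongrightarrow> (\<integral>x. g' x \<partial>lborel)"
  proof (rule integral_dominated_convergence)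
    show "integrable lborel (\<lambda>x. norm (g' x))" using int by simp
    show "AE x in lborel. (\<lambda>n. indicator {- real n..real n} x *\<^sub>R g' x) \<longlonglongrightarrow> g' x"
    proof (intro AE_I2 tendsto_eventually)
      fix x :: real
      obtain N where N: "\<bar>x\<bar> \<le> real N" using real_arch_simple by blast
      show "\<forall>\<^sub>F n in sequentially. indicator {- real n..real n} x *\<^sub>R g' x = g' x"
        proof (rule eventually_mono[OF eventually_ge_at_top[of N]])
        fix n assume "N \<le> n"
        then have "\<bar>x\<bar> \<le> real n" using N by (meson of_nat_le_iff order_trans)
        then show "indicator {- real n..real n} x *\<^sub>R g' x = g' x"
          by (simp add: indicator_def abs_le_iff)
      qed
    qed
  qed (auto simp: indicator_def)
  moreover have "(\<integral>x. indicator {- real n..real n} x *\<^sub>R g' x \<partial>lborel) = g (real n) - g (- real n)" for n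
    using der cont
    by (intro integral_FTC_Icc) (auto intro: has_vector_derivative_at_within continuous_on_subset)
  moreover have "(\<lambda>n. g (real n) - g (- real n)) \<longlonglongrightarrow> 0 - 0"
    using quadratic_decay_tendsto[OF \<open>quadratic_decay g\<close>] by (intro tendsto_diff)
  ultimately show ?thesis
    using LIMSEQ_unique by auto
qed

lemma measurable_cis [measurable]: "cis \<in> borel_measurable borel"
  by (intro borel_measurable_continuous_onI continuous_intros)

lemma cis_has_vector_derivative:
  "((\<lambda>x. cis (c * x)) has_vector_derivative (\<i> * of_real c * cis (c * x))) (at x)"
  unfolding cis_conv_exp of_real_mult
  by (rule has_vector_derivative_real_field[where f = "\<lambda>z. exp (\<i> * (of_real c * z))"])
     (auto intro!: derivative_eq_intros)

lemma quadratic_decay_mult_cis: "quadratic_decay f \<Longrightarrow> quadratic_decay (\<lambda>x. f x * cis (u x))"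
  by (simp add: quadratic_decay_def norm_mult)

lemma quadratic_decay_mult_cis_const:
  assumes "quadratic_decay f" shows "quadratic_decay (\<lambda>x. f x * (c * cis (u x)))"
proof -
  obtain C where C: "C \<ge> 0" "\<And>t. norm (f t) \<le> C * inv_quadratic t" using assms(1) by (auto simp: quadratic_decay_def)
  show ?thesis unfolding quadratic_decay_def
  proof (intro exI[of _ "C * norm c"] conjI allI)
    fix t
    have "norm (f t) * norm c \<le> C * inv_quadratic t * norm c"
      by (intro mult_right_mono C) simp
    then show "norm (f t * (c * cis (u t))) \<le> C * norm c * inv_quadratic t"
      by (simp add: norm_mult mult_ac)
  qed (use C in simp)
qed

lemma quadratic_decay_add:
  assumes "quadratic_decay f" "quadratic_decay g" shows "quadratic_decay (\<lambda>x. f x + g x)"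
proof -
  obtain C where C: "C \<ge> 0" "\<And>t. norm (f t) \<le> C * inv_quadratic t" using assms(1) by (auto simp: quadratic_decay_def)
  obtain D where D: "D \<ge> 0" "\<And>t. norm (g t) \<le> D * inv_quadratic t" using assms(2) by (auto simp: quadratic_decay_def)
  show ?thesis unfolding quadratic_decay_def
  proof (intro exI[of _ "C + D"] conjI allI)
    fix t show "norm (f t + g t) \<le> (C + D) * inv_quadratic t"
      using norm_triangle_ineq[of "f t" "g t"] C(2)[of t] D(2)[of t] by (simp add: algebra_simps)
  qed (use C D in simp)
qed

text \<open>Integration by parts: the integral of the derivative of $f(x)\,e^{-2\pi i x\xi}$
vanishes.\<close>

lemma fourier_real_deriv:
  assumes der: "\<And>x. (f has_vector_derivative f' x) (at x)"
    and cont: "continuous_on UNIV f'"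
    and dec: "quadratic_decay f" "quadratic_decay f'"
  shows "fourier_real f' \<xi> = 2 * pi * \<i> * \<xi> * fourier_real f \<xi>"
proof -
  have contf: "continuous_on UNIV f"
    using der by (meson continuous_at_imp_continuous_on has_vector_derivative_continuous)
  have [measurable]: "f \<in> borel_measurable borel" "f' \<in> borel_measurable borel"
    using contf cont by (auto intro: borel_measurable_continuous_onI)
  define c where "c = - 2 * pi * \<xi>"
  have eq: "cis (- 2 * pi * x * \<xi>) = cis (c * x)" for x
    by (simp add: c_def mult_ac)
  have fr: "fourier_real h \<xi> = (\<integral>x. h x * cis (c * x) \<partial>lborel)" for h
    unfolding fourier_real_def eq ..
  have "(\<integral>x. f' x * cis (c * x) + f x * (\<i> * of_real c * cis (c * x)) \<partial>lborel) = 0"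
  proof (rule integral_deriv_eq_0[where g = "\<lambda>x. f x * cis (c * x)"])
    show "((\<lambda>x. f x * cis (c * x)) has_vector_derivative
        f' x * cis (c * x) + f x * (\<i> * of_real c * cis (c * x))) (at x)" for x
      using has_vector_derivative_mult[OF der[of x] cis_has_vector_derivative[of c x]] by (simp add: add.commute)
    show "continuous_on UNIV (\<lambda>x. f' x * cis (c * x) + f x * (\<i> * of_real c * cis (c * x)))"
      by (intro continuous_intros cont contf)
    show "quadratic_decay (\<lambda>x. f x * cis (c * x))" by (intro quadratic_decay_mult_cis dec)
    show "quadratic_decay (\<lambda>x. f' x * cis (c * x) + f x * (\<i> * of_real c * cis (c * x)))"
      by (intro quadratic_decay_add quadratic_decay_mult_cis quadratic_decay_mult_cis_const dec)
  qed
  moreover have "(\<integral>x. f' x * cis (c * x) + f x * (\<i> * of_real c * cis (c * x)) \<partial>lborel)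
      = (\<integral>x. f' x * cis (c * x) \<partial>lborel) + (\<integral>x. (\<i> * of_real c) * (f x * cis (c * x)) \<partial>lborel)"
    by (subst Bochner_Integration.integral_add[symmetric])
       (auto simp: mult_ac intro!: quadratic_decay_integrable quadratic_decay_mult_cis quadratic_decay_mult_cis_const dec
             Bochner_Integration.integrable_mult_right)
  moreover have "(\<integral>x. (\<i> * of_real c) * (f x * cis (c * x)) \<partial>lborel) = (\<i> * of_real c) * fourier_real f \<xi>"
    unfolding fr by (subst Bochner_Integration.integral_mult_right)
       (auto intro!: quadratic_decay_integrable quadratic_decay_mult_cis dec)
  ultimately have "fourier_real f' \<xi> + (\<i> * of_real c) * fourier_real f \<xi> = 0"
    by (simp add: fr)
  then show ?thesis by (simp add: c_def add_eq_0_iff mult_ac)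
qed

lemma norm_fourier_real_le:
  "norm (fourier_real f \<xi>) \<le> (\<integral>x. norm (f x) \<partial>lborel)"
  unfolding fourier_real_def by (rule order.trans[OF integral_norm_bound]) (simp add: norm_mult)

lemma measurable_fourier_real:
  assumes [measurable]: "f \<in> borel_measurable borel"
  shows "fourier_real f \<in> borel_measurable borel"
  unfolding fourier_real_def by measurable

text \<open>Two integrations by parts show that $(2\pi\xi)^2 |\hat f(\xi)|$ is bounded by the
$L^1$ norm of $f''$.\<close>

lemma fourier_real_quadratic_decay:
  assumes der: "\<And>x. (f has_vector_derivative f' x) (at x)" "\<And>x. (f' has_vector_derivative f'' x) (at x)"
    and cont: "continuous_on UNIV f''"
    and dec: "quadratic_decay f" "quadratic_decay f'" "quadratic_decay f''"
  shows "quadratic_decay (fourier_real f)"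
proof -
  have contf': "continuous_on UNIV f'"
    using der(2) by (meson continuous_at_imp_continuous_on has_vector_derivative_continuous)
  define A where "A = (\<integral>x. norm (f x) \<partial>lborel) + (\<integral>x. norm (f'' x) \<partial>lborel)"
  have A0: "0 \<le> A" unfolding A_def by (intro add_nonneg_nonneg Bochner_Integration.integral_nonneg) auto
  have "norm (fourier_real f \<xi>) \<le> A * inv_quadratic \<xi>" for \<xi>
  proof -
    have "fourier_real f'' \<xi> = (2 * pi * \<i> * \<xi>)\<^sup>2 * fourier_real f \<xi>"
      using fourier_real_deriv[OF der(1) contf' dec(1,2), of \<xi>] fourier_real_deriv[OF der(2) cont dec(2,3), of \<xi>]
      by (simp add: power2_eq_square mult_ac)
    then have "norm (fourier_real f'' \<xi>) = (2 * pi)\<^sup>2 * \<xi>\<^sup>2 * norm (fourier_real f \<xi>)"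
      by (simp add: norm_mult norm_power power_mult_distrib)
    moreover have "1 * \<xi>\<^sup>2 * norm (fourier_real f \<xi>) \<le> (2 * pi)\<^sup>2 * \<xi>\<^sup>2 * norm (fourier_real f \<xi>)"
      using pi_gt3 by (intro mult_right_mono) (auto simp: abs_le_square_iff[of 1 "2 * pi", simplified, symmetric])
    ultimately have "(1 + \<xi>\<^sup>2) * norm (fourier_real f \<xi>) \<le> A"
      using norm_fourier_real_le[of f \<xi>] norm_fourier_real_le[of f'' \<xi>]
      by (simp add: A_def algebra_simps)
    then show ?thesis
      by (simp add: inv_quadratic_def divide_simps add_pos_nonneg mult.commute)
  qed
  with A0 show ?thesis by (auto simp: quadratic_decay_def)
qed

section \<open>Fourier coefficients of bounded functions\<close>

lemma finite_measure_cell: "finite_measure (cell {a..<a + 1::real})"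
  by (rule finite_measureI) (simp add: emeasure_restrict_space)

lemma space_cell: "Q \<in> sets borel \<Longrightarrow> space (cell Q) = Q"
  by (simp add: space_restrict_space)

lemma integral_cis_cell:
  "(\<integral>t. cis (2 * pi * of_int n * t) \<partial>cell {a..<a + 1}) = (if n = 0 then 1 else 0)"
proof (cases "n = 0")
  case True
  interpret finite_measure "cell {a..<a + 1}" by (rule finite_measure_cell)
  have "measure (cell {a..<a + 1}) {a..<a + 1} = 1"
    by (simp add: measure_def emeasure_restrict_space)
  then show ?thesis using True by (simp add: space_cell)
next
  case False
  define c where "c = 2 * pi * of_int n"
  have c0: "c \<noteq> 0" using False by (simp add: c_def)
  have "(\<integral>t. cis (c * t) \<partial>cell {a..<a + 1}) = (\<integral>t. indicator {a..<a + 1} t *\<^sub>R cis (c * t) \<partial>lborel)"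
    by (subst integral_restrict_space) auto
  also have "\<dots> = (\<integral>t. indicator {a..a + 1} t *\<^sub>R cis (c * t) \<partial>lborel)"
  proof (rule integral_cong_AE)
    show "AE t in lborel. indicator {a..<a + 1} t *\<^sub>R cis (c * t) = indicator {a..a + 1} t *\<^sub>R cis (c * t)"
      using AE_lborel_singleton[of "a + 1"] by eventually_elim (auto simp: indicator_def)
  qed auto
  also have "\<dots> = cis (c * (a + 1)) / (\<i> * c) - cis (c * a) / (\<i> * c)"
  proof (rule integral_FTC_Icc)
    fix x
    have "((\<lambda>x. cis (c * x) / (\<i> * c)) has_vector_derivative \<i> * of_real c * cis (c * x) / (\<i> * c))
        (at x within {a..a+1})"
      by (rule has_vector_derivative_at_within[OF has_vector_derivative_divide[OF cis_has_vector_derivative]])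
    then show "((\<lambda>x. cis (c * x) / (\<i> * c)) has_vector_derivative cis (c * x)) (at x within {a..a+1})"
      using c0 by simp
  qed (auto intro!: continuous_intros)
  also have "\<dots> = 0"
  proof -
    have "cis (c * (a + 1)) = cis (c * a) * cis c"
      by (simp add: cis_mult algebra_simps)
    also have "cis c = 1"
      unfolding c_def by (simp add: cis_multiple_2pi)
    finally show ?thesis by simp
  qed
  finally show ?thesis using False by (simp add: c_def)
qed

text \<open>The period centred at the origin: $0$ is the only point of $[-\frac12,\frac12]$ at which
$e^{2\pi i t} = 1$.\<close>

definition unit_cell :: "real measure" where
  "unit_cell = cell {-1/2..<-1/2 + 1}"

lemma space_unit_cell [simp]: "space unit_cell = {-1/2..<1/2}"
  by (simp add: unit_cell_def space_cell)

lemma measurable_unit_cell: "f \<in> borel_measurable borel \<Longrightarrow> f \<in> borel_measurable unit_cell"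
  unfolding unit_cell_def by (rule measurable_restrict_space1) simp

lemma finite_measure_unit_cell: "finite_measure unit_cell"
  unfolding unit_cell_def by (rule finite_measure_cell)

lemma integral_cis_unit_cell:
  "(\<integral>t. cis (2 * pi * of_int n * t) \<partial>unit_cell) = (if n = 0 then 1 else 0)"
  unfolding unit_cell_def by (rule integral_cis_cell)

definition fcoeff :: "(real \<Rightarrow> complex) \<Rightarrow> int \<Rightarrow> complex" where
  "fcoeff q n = (\<integral>t. q t * cis (- 2 * pi * of_int n * t) \<partial>unit_cell)"

text \<open>The square of the distance from \<open>q\<close> to the partial sum of its Fourier series over \<open>A\<close> is
nonnegative; by orthonormality of the exponentials it equals the difference of the two sides.\<close>

lemma bessel_inequality:
  assumes [measurable]: "q \<in> borel_measurable unit_cell"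
    and bound: "\<And>t. t \<in> {-1/2..<1/2} \<Longrightarrow> norm (q t) \<le> B" and "finite A"
  shows "(\<Sum>n\<in>A. (norm (fcoeff q n))\<^sup>2) \<le> (\<integral>t. (norm (q t))\<^sup>2 \<partial>unit_cell)"
proof -
  interpret finite_measure unit_cell by (rule finite_measure_unit_cell)
  have [measurable]: "(\<lambda>t. cis (b * t)) \<in> borel_measurable unit_cell" for b
    by (rule measurable_unit_cell) measurable
  have [measurable]: "cnj \<in> borel_measurable borel"
    by (intro borel_measurable_continuous_onI continuous_intros)
  define c where "c = fcoeff q"
  define e where "e = (\<lambda>(n::int) t. cis (2 * pi * of_int n * t))"
  have e_meas[measurable]: "e n \<in> borel_measurable unit_cell" for n
    by (simp add: e_def)
  have B: "AE t in unit_cell. norm (q t) \<le> B"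
    using bound by (intro AE_I2) (simp add: space_cell)
  have norm_e [simp]: "norm (e n t) = 1" for n t by (simp add: e_def)
  have cnj_e: "cnj (e n t) = cis (- 2 * pi * of_int n * t)" for n t
    by (simp add: e_def cis_cnj)
  have qi: "integrable unit_cell (\<lambda>t. q t * cnj (e n t))" for n
    by (rule integrable_const_bound[of _ B]) (use B in \<open>auto simp: norm_mult\<close>)
  have ei: "integrable unit_cell (\<lambda>t. e n t * cnj (e m t))" for n m
    by (rule integrable_const_bound[of _ 1]) (auto simp: norm_mult)
  have c_eq: "(\<integral>t. q t * cnj (e n t) \<partial>unit_cell) = c n" for n
    by (simp add: c_def fcoeff_def cnj_e)
  have orth: "(\<integral>t. e n t * cnj (e m t) \<partial>unit_cell) = (if n = m then 1 else 0)" for n m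
  proof -
    have "e n t * cnj (e m t) = cis (2 * pi * of_int (n - m) * t)" for t
      by (simp add: e_def cis_cnj cis_mult algebra_simps)
    then show ?thesis using integral_cis_unit_cell[of "n - m"] by simp
  qed
  define s where "s = (\<lambda>t. \<Sum>n\<in>A. c n * e n t)"
  have [measurable]: "s \<in> borel_measurable unit_cell" unfolding s_def by measurable
  have sb: "norm (s t) \<le> (\<Sum>n\<in>A. norm (c n))" for t
    unfolding s_def by (rule order.trans[OF norm_sum]) (simp add: norm_mult)
  have qq: "integrable unit_cell (\<lambda>t. q t * cnj (q t))"
  proof (rule integrable_const_bound[of _ "B * B"])
    show "AE t in unit_cell. norm (q t * cnj (q t)) \<le> B * B"
      using B by eventually_elim (auto simp: norm_mult intro!: mult_mono order.trans[OF norm_ge_zero])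
  qed auto
  have qs: "integrable unit_cell (\<lambda>t. q t * cnj (s t))"
  proof (rule integrable_const_bound[of _ "B * (\<Sum>n\<in>A. norm (c n))"])
    show "AE t in unit_cell. norm (q t * cnj (s t)) \<le> B * (\<Sum>n\<in>A. norm (c n))"
      using B by eventually_elim (auto simp: norm_mult sb intro!: mult_mono order.trans[OF norm_ge_zero])
  qed auto
  have ss: "integrable unit_cell (\<lambda>t. s t * cnj (s t))"
    by (rule integrable_const_bound[of _ "(\<Sum>n\<in>A. norm (c n)) * (\<Sum>n\<in>A. norm (c n))"])
       (auto simp: norm_mult intro!: mult_mono sb sum_nonneg)
  have sq: "z * cnj z = complex_of_real ((norm z)\<^sup>2)" for z
    by (rule complex_norm_square[symmetric])
  have int_qs: "(\<integral>t. q t * cnj (s t) \<partial>unit_cell) = (\<Sum>n\<in>A. c n * cnj (c n))"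
  proof -
    have "(\<integral>t. q t * cnj (s t) \<partial>unit_cell) = (\<integral>t. (\<Sum>n\<in>A. cnj (c n) * (q t * cnj (e n t))) \<partial>unit_cell)"
      by (simp add: s_def sum_distrib_left mult_ac)
    also have "\<dots> = (\<Sum>n\<in>A. cnj (c n) * c n)"
      by (subst Bochner_Integration.integral_sum) (auto simp: qi c_eq)
    finally show ?thesis by (simp add: mult.commute)
  qed
  have int_ss: "(\<integral>t. s t * cnj (s t) \<partial>unit_cell) = (\<Sum>n\<in>A. c n * cnj (c n))"
  proof -
    have "(\<integral>t. s t * cnj (s t) \<partial>unit_cell)
        = (\<integral>t. (\<Sum>n\<in>A. \<Sum>m\<in>A. c n * cnj (c m) * (e n t * cnj (e m t))) \<partial>unit_cell)"
      by (simp add: s_def sum_product mult_ac)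
    also have "\<dots> = (\<Sum>n\<in>A. \<Sum>m\<in>A. c n * cnj (c m) * (if n = m then 1 else 0))"
      by (simp add: Bochner_Integration.integral_sum ei orth)
    also have "\<dots> = (\<Sum>n\<in>A. c n * cnj (c n))"
      using \<open>finite A\<close> by (simp add: sum.delta if_distrib[of "\<lambda>x. _ * x"] cong: if_cong)
    finally show ?thesis .
  qed
  have int_sq: "(\<integral>t. cnj (q t * cnj (s t)) \<partial>unit_cell) = (\<Sum>n\<in>A. c n * cnj (c n))"
    by (simp only: Bochner_Integration.integral_cnj int_qs) (simp add: mult.commute)
  have "(\<integral>t. (q t - s t) * cnj (q t - s t) \<partial>unit_cell)
      = (\<integral>t. q t * cnj (q t) - q t * cnj (s t) - cnj (q t * cnj (s t)) + s t * cnj (s t) \<partial>unit_cell)"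
    by (simp add: algebra_simps)
  also have "\<dots> = (\<integral>t. q t * cnj (q t) \<partial>unit_cell) - (\<Sum>n\<in>A. c n * cnj (c n))"
    using qq qs ss qs[THEN integrable_cnj]
    by (simp add: Bochner_Integration.integral_add Bochner_Integration.integral_diff int_qs int_ss int_sq
        del: complex_cnj_mult Bochner_Integration.integral_cnj)
  finally have "complex_of_real (\<integral>t. (norm (q t - s t))\<^sup>2 \<partial>unit_cell)
      = of_real ((\<integral>t. (norm (q t))\<^sup>2 \<partial>unit_cell) - (\<Sum>n\<in>A. (norm (c n))\<^sup>2))"
    by (simp only: sq Bochner_Integration.integral_complex_of_real of_real_diff of_real_sum)
  then have "(\<integral>t. (norm (q t))\<^sup>2 \<partial>unit_cell) - (\<Sum>n\<in>A. (norm (c n))\<^sup>2) = (\<integral>t. (norm (q t - s t))\<^sup>2 \<partial>unit_cell)"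
    by (simp only: of_real_eq_iff)
  also have "\<dots> \<ge> 0" by (rule Bochner_Integration.integral_nonneg) simp
  finally show ?thesis by (simp add: c_def)
qed

text \<open>By Bessel's inequality the coefficients along any sequence of distinct frequencies
are square summable.\<close>

lemma riemann_lebesgue_bounded:
  assumes "q \<in> borel_measurable unit_cell"
    and "\<And>t. t \<in> {-1/2..<1/2} \<Longrightarrow> norm (q t) \<le> B"
    and "inj (u :: nat \<Rightarrow> int)"
  shows "(\<lambda>N. fcoeff q (u N)) \<longlonglongrightarrow> 0"
proof -
  have "summable (\<lambda>N. (norm (fcoeff q (u N)))\<^sup>2)"
  proof (rule summableI_nonneg_bounded)
    fix n
    have "(\<Sum>N<n. (norm (fcoeff q (u N)))\<^sup>2) = (\<Sum>k\<in>u ` {..<n}. (norm (fcoeff q k))\<^sup>2)"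
      using assms(3) by (subst sum.reindex) (auto intro: inj_on_subset)
    also have "\<dots> \<le> (\<integral>t. (norm (q t))\<^sup>2 \<partial>unit_cell)"
      by (rule bessel_inequality[OF assms(1,2)]) auto
    finally show "(\<Sum>N<n. (norm (fcoeff q (u N)))\<^sup>2) \<le> (\<integral>t. (norm (q t))\<^sup>2 \<partial>unit_cell)" .
  qed simp
  then have "(\<lambda>N. (norm (fcoeff q (u N)))\<^sup>2) \<longlonglongrightarrow> 0" by (rule summable_LIMSEQ_zero)
  then show ?thesis
    by (simp add: tendsto_norm_zero_iff)
qed

text \<open>One has $|e^{2\pi i t}-1| = 2|\sin \pi t|$. The bound on the sine is obtained
from $\sin y \ge y/2$ on $[0,1]$ by doubling the angle once; only its linear order in $t$ matters.\<close>

lemma norm_cis_minus_1_ge: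
  assumes "\<bar>t\<bar> \<le> 1 / 2" shows "\<bar>t\<bar> \<le> norm (cis (2 * pi * t) - 1)"
proof -
  have sin_quarter: "y / 2 \<le> sin y" if "0 \<le> y" "y \<le> 1" for y :: real
  proof -
    have "\<bar>sin y - (\<Sum>m<2. sin_coeff m * y ^ m)\<bar> \<le> inverse (fact 2) * \<bar>y\<bar> ^ 2"
      by (rule Maclaurin_sin_bound)
    then have "\<bar>sin y - y\<bar> \<le> y\<^sup>2 / 2"
      by (simp add: sin_coeff_def numeral_2_eq_2)
    moreover have "y\<^sup>2 \<le> y" using that by (simp add: power2_eq_square mult_left_le)
    ultimately show ?thesis by linarith
  qed
  define y where "y = pi * \<bar>t\<bar> / 2"
  have y: "0 \<le> y" "y \<le> pi / 4" using assms by (auto simp: y_def field_simps)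
  have "sin (2 * y) = 2 * sin y * cos y" by (rule sin_double)
  moreover have "1 / 2 \<le> cos y"
  proof -
    have "cos (pi / 3) \<le> cos y" using y pi_gt_zero by (intro cos_monotone_0_pi_le) auto
    then show ?thesis by (simp add: cos_60)
  qed
  moreover have "y / 2 \<le> sin y" using y pi_less_4 by (intro sin_quarter) auto
  ultimately have "y / 2 \<le> sin (2 * y)"
    using mult_mono[of "y / 2" "sin y" "1 / 2" "cos y"] y by (auto simp: mult_ac)
  moreover have "sin (2 * y) \<le> norm (sin (pi * t))"
    by (cases "t \<ge> 0") (auto simp: y_def)
  moreover have "norm (cis (2 * pi * t) - 1) = 2 * norm (sin (pi * t))"
  proof -
    have "cis (2 * pi * t) - 1 = cis (pi * t) * (cis (pi * t) - cis (- (pi * t)))"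
      by (simp add: algebra_simps cis_mult)
    also have "cis (pi * t) - cis (- (pi * t)) = 2 * \<i> * sin (pi * t)"
      by (simp add: complex_eq_iff)
    finally show ?thesis by (simp add: norm_mult)
  qed
  moreover have "\<bar>t\<bar> \<le> y" using pi_gt3 mult_right_mono[of 3 pi "\<bar>t\<bar>"] by (simp add: y_def)
  ultimately show ?thesis by linarith
qed

section \<open>The Poisson summation formula\<close>

lemma integral_count_space_symmetric_limit:
  fixes f :: "int \<Rightarrow> complex"
  assumes "integrable (count_space UNIV) f"
  shows "(\<lambda>N. \<Sum>m\<in>{- int N..int N}. f m) \<longlonglongrightarrow> (\<integral>m. f m \<partial>count_space UNIV)"
proof -
  have "(\<lambda>N. \<integral>m. indicator {- int N..int N} m *\<^sub>R f m \<partial>count_space UNIV) \<longlonglongrightarrow> (\<integral>m. f m \<partial>count_space UNIV)"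
  proof (rule integral_dominated_convergence)
    show "integrable (count_space UNIV) (\<lambda>m. norm (f m))" using assms by simp
    show "AE m in count_space UNIV. (\<lambda>N. indicator {- int N..int N} m *\<^sub>R f m) \<longlonglongrightarrow> f m"
    proof (intro AE_I2 tendsto_eventually eventually_mono[OF eventually_ge_at_top])
      fix m :: int and N assume "nat \<bar>m\<bar> \<le> N"
      then show "indicator {- int N..int N} m *\<^sub>R f m = f m" by (auto simp: indicator_def)
    qed
  qed (auto simp: indicator_def)
  moreover have "(\<integral>m. indicator {- int N..int N} m *\<^sub>R f m \<partial>count_space UNIV) = (\<Sum>m\<in>{- int N..int N}. f m)" for N
    by (subst integral_restrict_space[symmetric])
       (simp_all add: restrict_count_space lebesgue_integral_count_space_finite)
  ultimately show ?thesis by simp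
qed

lemma cis_int_period: "cis (u + 2 * pi * of_int n) = cis u"
  by (simp add: cis_multiple_2pi flip: cis_mult)

text \<open>Chernoff's proof of pointwise convergence of Fourier series, applied to the periodisation
$S(t) = \sum_k h(t+k)$. The decay of $h'$ makes $S$ Lipschitz at $0$, so $q(t) = (S(t)-S(0))/(e^{2\pi i t}-1)$ is
bounded. The Fourier coefficients of $S$, which are the values of $\hat h$ at the integers, are the differences of
consecutive coefficients of $q$, except for an extra $S(0)$ at frequency $0$; their symmetric sums therefore telescope
to $S(0)$ plus two terms that tend to $0$.\<close>

lemma poisson_at_0:
  assumes der: "\<And>x. (h has_vector_derivative h' x) (at x)"
    and dec: "quadratic_decay h" "quadratic_decay h'"
    and summ: "integrable (count_space UNIV) (\<lambda>m::int. fourier_real h (of_int m))"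
  shows "(\<integral>m. fourier_real h (real_of_int m) \<partial>count_space UNIV) = (\<integral>k. h (real_of_int k) \<partial>count_space UNIV)"
proof -
  have "continuous_on UNIV h"
    using der by (meson continuous_at_imp_continuous_on has_vector_derivative_continuous)
  then have [measurable]: "h \<in> borel_measurable borel"
    by (rule borel_measurable_continuous_onI)
  interpret finite_measure unit_cell by (rule finite_measure_unit_cell)
  interpret C: sigma_finite_measure "count_space (UNIV :: int set)"
    by (rule sigma_finite_measure_count_space)
  obtain C where C: "0 \<le> C" "\<And>t. norm (h' t) \<le> C * inv_quadratic t" using dec(2) by (auto simp: quadratic_decay_def)
  define S where "S = (\<lambda>t. \<integral>k. h (t + real_of_int k) \<partial>count_space UNIV)"
  have "(\<lambda>(t, k). h (t + real_of_int k)) \<in> borel_measurable (borel \<Otimes>\<^sub>M count_space UNIV)"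
    by (rule measurable_pair_countable2) simp
  then have S_borel[measurable]: "S \<in> borel_measurable borel"
    unfolding S_def by (rule C.borel_measurable_lebesgue_integral)
  define L where "L = (\<integral>k. 4 * C * inv_quadratic (real_of_int k) \<partial>count_space UNIV)"
  have L0: "0 \<le> L" unfolding L_def using C by (intro Bochner_Integration.integral_nonneg) simp
  have Lip: "norm (S t - S 0) \<le> L * \<bar>t\<bar>" if t: "\<bar>t\<bar> \<le> 1" for t
  proof -
    have term_bound: "norm (h (t + k) - h (0 + k)) \<le> 4 * C * inv_quadratic k * \<bar>t\<bar>" for k
    proof -
      have "norm (h (t + k) - h (0 + k)) \<le> 4 * C * inv_quadratic k * norm ((t + k) - (0 + k))"
      proof (rule differentiable_bound)
        show "convex {k - 1..k + 1}" by simp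
        fix s assume s: "s \<in> {k - 1..k + 1}"
        show "(h has_derivative (\<lambda>u. u *\<^sub>R h' s)) (at s within {k - 1..k + 1})"
          using der[of s] unfolding has_vector_derivative_def by (rule has_derivative_at_withinI)
        have "norm (h' s) \<le> C * (4 * inv_quadratic k)"
          using C inv_quadratic_shift_unit[of "s - k" k] s
          by (intro order.trans[OF C(2)[of s]] mult_left_mono) auto
        then have "norm (h' s) \<le> 4 * C * inv_quadratic k" by simp
        from mult_left_mono[OF this abs_ge_zero] show "onorm (\<lambda>u. u *\<^sub>R h' s) \<le> 4 * C * inv_quadratic k"
          by (intro onorm_le) (simp add: mult.commute)
      qed (use t in auto)
      then show ?thesis by simp
    qed
    have int: "integrable (count_space UNIV) (\<lambda>k::int. h (u + of_int k))" for u
      by (rule quadratic_decay_integrable_int[OF dec(1)])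
    have "norm (S t - S 0) = norm (\<integral>k. h (t + real_of_int k) - h (0 + real_of_int k) \<partial>count_space UNIV)"
      unfolding S_def Bochner_Integration.integral_diff[OF int int] ..
    also have "\<dots> \<le> (\<integral>k. 4 * C * inv_quadratic (real_of_int k) * \<bar>t\<bar> \<partial>count_space UNIV)"
    proof (rule order.trans[OF integral_norm_bound Bochner_Integration.integral_mono])
      show "integrable (count_space UNIV) (\<lambda>k::int. norm (h (t + of_int k) - h (0 + of_int k)))"
        by (intro integrable_norm Bochner_Integration.integrable_diff int)
      show "integrable (count_space UNIV) (\<lambda>k. 4 * C * inv_quadratic (real_of_int k) * \<bar>t\<bar>)"
        using integrable_inv_quadratic_int by (intro integrable_mult_left integrable_mult_right)
    qed (use term_bound in simp)
    also have "\<dots> = L * \<bar>t\<bar>"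
      unfolding L_def by simp
    finally show ?thesis .
  qed
  \<comment> \<open>At $t = 0$ the quotient has the value $0$, and the identity \<open>q_eq\<close> still holds there.\<close>
  define q where "q = (\<lambda>t. (S t - S 0) / (cis (2 * pi * t) - 1))"
  have q_meas[measurable]: "q \<in> borel_measurable unit_cell"
    unfolding q_def by (rule measurable_unit_cell) measurable
  have q_eq: "S t = S 0 + q t * (cis (2 * pi * t) - 1)" if "\<bar>t\<bar> \<le> 1 / 2" for t
    using norm_cis_minus_1_ge[OF that] by (cases "t = 0") (auto simp: q_def)
  have q_bound: "norm (q t) \<le> L" if "t \<in> {-1/2..<1/2}" for t
  proof -
    have t: "\<bar>t\<bar> \<le> 1 / 2" using that by auto
    have "norm (S t - S 0) \<le> L * norm (cis (2 * pi * t) - 1)"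
      using Lip[of t] t mult_left_mono[OF norm_cis_minus_1_ge[OF t] L0] by linarith
    then show ?thesis
      using L0 by (cases "cis (2 * pi * t) = 1") (auto simp: q_def norm_divide divide_simps)
  qed
  have fourier_eq: "fourier_real h (of_int m) = fcoeff S m" for m
  proof -
    have "fourier_real h (of_int m)
        = (\<integral>t. (\<integral>k. h (t + real_of_int k) * cis (- 2 * pi * (t + real_of_int k) * of_int m) \<partial>count_space UNIV) \<partial>unit_cell)"
      unfolding fourier_real_def unit_cell_def
      by (rule integral_tiling[OF tiling_real]) (intro quadratic_decay_integrable quadratic_decay_mult_cis dec, measurable)
    also have "\<dots> = (\<integral>t. (\<integral>k. h (t + real_of_int k) * cis (- 2 * pi * of_int m * t) \<partial>count_space UNIV) \<partial>unit_cell)"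
    proof -
      have "cis (- 2 * pi * (t + real_of_int k) * of_int m) = cis (- 2 * pi * of_int m * t)" for t and k :: int
        using cis_int_period[of "- 2 * pi * of_int m * t" "- m * k"] by (simp add: algebra_simps)
      then show ?thesis by simp
    qed
    also have "\<dots> = fcoeff S m"
      unfolding fcoeff_def S_def by simp
    finally show ?thesis .
  qed
  have qi: "integrable unit_cell (\<lambda>t. q t * cis (b * t))" for b
  proof (rule integrable_const_bound[of _ L])
    show "(\<lambda>t. q t * cis (b * t)) \<in> borel_measurable unit_cell"
      by (intro borel_measurable_times q_meas measurable_unit_cell) measurable
  qed (use q_bound in \<open>auto simp: norm_mult intro!: AE_I2\<close>)
  have ci: "integrable unit_cell (\<lambda>t. c * cis (b * t))" for b and c :: complex
    by (rule integrable_const_bound[of _ "norm c"]) (auto simp: norm_mult intro!: measurable_unit_cell)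
  have step: "fcoeff S m = (if m = 0 then S 0 else 0) + fcoeff q (m - 1) - fcoeff q m" for m
  proof -
    have "fcoeff S m = (\<integral>t. S 0 * cis (2 * pi * of_int (- m) * t) + q t * cis (- 2 * pi * of_int (m - 1) * t)
        - q t * cis (- 2 * pi * of_int m * t) \<partial>unit_cell)"
      unfolding fcoeff_def
    proof (rule Bochner_Integration.integral_cong[OF refl])
      fix t assume "t \<in> space unit_cell"
      then have "\<bar>t\<bar> \<le> 1 / 2" by auto
      moreover have "cis (2 * pi * t) * cis (- 2 * pi * of_int m * t) = cis (- 2 * pi * of_int (m - 1) * t)"
        by (simp add: cis_mult algebra_simps)
      moreover have "S t * u = S 0 * u + q t * (v * u) - q t * u" if "S t = S 0 + q t * (v - 1)" for u v
        unfolding that by (simp add: algebra_simps)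
      moreover have "2 * pi * of_int (- m) * t = - 2 * pi * of_int m * t" by simp
      ultimately show "S t * cis (- 2 * pi * of_int m * t) = S 0 * cis (2 * pi * of_int (- m) * t)
          + q t * cis (- 2 * pi * of_int (m - 1) * t) - q t * cis (- 2 * pi * of_int m * t)"
        using q_eq[of t] by metis
    qed
    also have "\<dots> = S 0 * (\<integral>t. cis (2 * pi * of_int (- m) * t) \<partial>unit_cell) + fcoeff q (m - 1) - fcoeff q m"
      unfolding fcoeff_def
      by (simp only: Bochner_Integration.integral_diff Bochner_Integration.integral_add qi ci
          Bochner_Integration.integrable_add integral_mult_right_zero)
    finally show ?thesis by (simp only: integral_cis_unit_cell) simp
  qed
  \<comment> \<open>The extra term $S(0)$ enters exactly once, at frequency $0$.\<close>
  have tele: "(\<Sum>m\<in>{- int N..int N}. fcoeff S m) = S 0 + fcoeff q (- int N - 1) - fcoeff q (int N)" for N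
  proof (induction N)
    case 0
    show ?case by (simp add: step)
  next
    case (Suc N)
    have "{- int (Suc N)..int (Suc N)} = insert (- int N - 1) (insert (int N + 1) {- int N..int N})"
      by auto
    then have "(\<Sum>m\<in>{- int (Suc N)..int (Suc N)}. fcoeff S m)
        = fcoeff S (- int N - 1) + (fcoeff S (int N + 1) + (\<Sum>m\<in>{- int N..int N}. fcoeff S m))"
      by simp
    moreover have "fcoeff S (- int N - 1) = fcoeff q (- int (Suc N) - 1) - fcoeff q (- int N - 1)"
      using step[of "- int N - 1"] by simp
    moreover have "fcoeff S (int N + 1) = fcoeff q (int N) - fcoeff q (int (Suc N))"
      using step[of "int N + 1"] by (simp add: add.commute)
    ultimately have "(\<Sum>m\<in>{- int (Suc N)..int (Suc N)}. fcoeff S m)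
        = S 0 + fcoeff q (- int (Suc N) - 1) - fcoeff q (int (Suc N))"
      by (simp only: Suc.IH) (simp add: algebra_simps del: of_nat_Suc)
    then show ?case .
  qed
  have "(\<lambda>N. S 0 + fcoeff q (- int N - 1) - fcoeff q (int N)) \<longlonglongrightarrow> S 0 + 0 - 0"
    by (intro tendsto_intros riemann_lebesgue_bounded[where B = L] q_bound q_meas) (auto simp: inj_def)
  moreover have "(\<lambda>N. S 0 + fcoeff q (- int N - 1) - fcoeff q (int N))
      \<longlonglongrightarrow> (\<integral>m. fourier_real h (real_of_int m) \<partial>count_space UNIV)"
    using integral_count_space_symmetric_limit[OF summ] by (simp add: fourier_eq tele)
  ultimately show ?thesis
    using LIMSEQ_unique by (force simp: S_def)
qed

text \<open>The part of the definition of a Schwartz function that is used here: two derivatives,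
all with quadratic decay.\<close>

lemma schwartz_derivatives:
  assumes "f \<in> schwartz"
  obtains f' f'' where "\<And>x. (f has_vector_derivative f' x) (at x)" "\<And>x. (f' has_vector_derivative f'' x) (at x)"
    "continuous_on UNIV f''" "quadratic_decay f" "quadratic_decay f'" "quadratic_decay f''"
proof -
  obtain D where D: "D 0 = f" "\<And>n x. (D n has_vector_derivative D (Suc n) x) (at x)"
    "\<And>k n. \<exists>C. \<forall>x. \<bar>x\<bar> ^ k * norm (D n x) \<le> C"
    using assms unfolding schwartz_def by blast
  have wd: "quadratic_decay (D n)" for n
  proof -
    obtain A where A: "\<And>x. \<bar>x\<bar> ^ 0 * norm (D n x) \<le> A" using D(3) by blast
    obtain B where B: "\<And>x. \<bar>x\<bar> ^ 2 * norm (D n x) \<le> B" using D(3) by blast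
    have "norm (D n x) \<le> (A + B) * inv_quadratic x" for x
      using A[of x] B[of x] by (simp add: inv_quadratic_def divide_simps add_pos_nonneg algebra_simps)
    moreover have "0 \<le> A + B"
      using order.trans[OF norm_ge_zero, of "D n 0" A] A[of 0] B[of 0] by simp
    ultimately show ?thesis by (auto simp: quadratic_decay_def)
  qed
  have cont: "continuous_on UNIV (D n)" for n
    using D(2) by (meson continuous_at_imp_continuous_on has_vector_derivative_continuous)
  show ?thesis
    by (rule that[of "D 1" "D 2"])
       (use D(1) D(2)[of 0] D(2)[of 1] wd cont wd[of 0] in \<open>simp_all add: numeral_2_eq_2\<close>)
qed

lemma schwartz_continuous: "f \<in> schwartz \<Longrightarrow> continuous_on UNIV f"
  by (rule schwartz_derivatives)
     (auto intro: continuous_at_imp_continuous_on has_vector_derivative_continuous)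

lemma schwartz_measurable: "f \<in> schwartz \<Longrightarrow> f \<in> borel_measurable borel"
  by (intro borel_measurable_continuous_onI schwartz_continuous)

lemma schwartz_quadratic_decay: "f \<in> schwartz \<Longrightarrow> quadratic_decay f"
  by (rule schwartz_derivatives)

lemma schwartz_fourier_quadratic_decay: "f \<in> schwartz \<Longrightarrow> quadratic_decay (fourier_real f)"
  by (erule schwartz_derivatives) (rule fourier_real_quadratic_decay)

lemma quadratic_decay_shift: "quadratic_decay f \<Longrightarrow> quadratic_decay (\<lambda>t. f (x + t))"
  using quadratic_decay_shift_bound[of f x] by (simp add: quadratic_decay_def)

text \<open>This is \<open>poisson_at_0\<close> for the function $t \mapsto f(x+t)\,e^{-2\pi i \theta t}$, whose Fourier
transform is a translated and modulated copy of $\hat f$.\<close>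

lemma poisson_summation:
  assumes "f \<in> schwartz"
  shows "(\<integral>m. fourier_real f (\<theta> + real_of_int m) * cis (2 * pi * x * (\<theta> + real_of_int m)) \<partial>count_space UNIV)
       = (\<integral>k. f (x + real_of_int k) * cis (- 2 * pi * real_of_int k * \<theta>) \<partial>count_space UNIV)"
proof -
  obtain f' f'' where der: "\<And>x. (f has_vector_derivative f' x) (at x)"
    and dec: "quadratic_decay f" "quadratic_decay f'"
    by (rule schwartz_derivatives[OF assms]) blast
  have [measurable]: "f \<in> borel_measurable borel"
    by (rule schwartz_measurable[OF assms])
  define c where "c = - 2 * pi * \<theta>"
  define h where "h = (\<lambda>t. f (x + t) * cis (c * t))"
  define h' where "h' = (\<lambda>t. f' (x + t) * cis (c * t) + f (x + t) * (\<i> * of_real c * cis (c * t)))"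
  have four: "fourier_real h (real_of_int m) = fourier_real f (\<theta> + real_of_int m) * cis (2 * pi * x * (\<theta> + real_of_int m))" for m
  proof -
    define g where "g = (\<lambda>s. f s * cis (- 2 * pi * s * (\<theta> + real_of_int m)) * cis (2 * pi * x * (\<theta> + real_of_int m)))"
    have "h t * cis (- 2 * pi * t * real_of_int m) = g (t + x)" for t
    proof -
      have "c * t + - 2 * pi * t * real_of_int m
          = - 2 * pi * (t + x) * (\<theta> + real_of_int m) + 2 * pi * x * (\<theta> + real_of_int m)"
        by (simp add: c_def algebra_simps)
      then show ?thesis by (simp only: h_def g_def mult.assoc cis_mult add.commute[of t x])
    qed
    then have "fourier_real h (real_of_int m) = (\<integral>t. g (t + x) \<partial>lborel)"
      by (simp only: fourier_real_def)
    also have "\<dots> = (\<integral>s. g s \<partial>lborel)"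
      unfolding g_def by (rule integral_lborel_translate) measurable
    also have "\<dots> = fourier_real f (\<theta> + real_of_int m) * cis (2 * pi * x * (\<theta> + real_of_int m))"
      unfolding g_def fourier_real_def by simp
    finally show ?thesis .
  qed
  have "(\<integral>m. fourier_real h (real_of_int m) \<partial>count_space UNIV) = (\<integral>k. h (real_of_int k) \<partial>count_space UNIV)"
  proof (rule poisson_at_0)
    fix t
    have "((\<lambda>t. f (x + t)) has_vector_derivative f' (x + t)) (at t)"
      using vector_diff_chain_at[OF has_vector_derivative_add[OF has_vector_derivative_const has_vector_derivative_id],
          of f "f' (x + t)" x t] der[of "x + t"]
      by (simp add: o_def)
    from has_vector_derivative_mult[OF this cis_has_vector_derivative[of c t]]
    show "(h has_vector_derivative h' t) (at t)"
      by (simp add: h_def h'_def add.commute)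
  next
    show "quadratic_decay h" unfolding h_def by (intro quadratic_decay_mult_cis quadratic_decay_shift dec)
    show "quadratic_decay h'" unfolding h'_def
      by (intro quadratic_decay_add quadratic_decay_mult_cis quadratic_decay_mult_cis_const quadratic_decay_shift dec)
    show "integrable (count_space UNIV) (\<lambda>m. fourier_real h (real_of_int m))"
      unfolding four
      by (rule quadratic_decay_integrable_int[OF quadratic_decay_mult_cis[OF schwartz_fourier_quadratic_decay[OF assms]]])
  qed
  moreover have "h (real_of_int k) = f (x + real_of_int k) * cis (- 2 * pi * real_of_int k * \<theta>)" for k
    by (simp add: h_def c_def mult_ac)
  ultimately show ?thesis
    by (simp only: four)
qed

section \<open>A periodic Borel representative of the symbol\<close>

text \<open>The almost-everywhere periods of a function form a group, because null sets are
invariant under translations.\<close>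

lemma AE_lborel_lattice_periodic:
  fixes \<psi> :: "real \<times> real \<Rightarrow> complex"
  assumes "AE z in lborel. \<psi> (z + (1, 0)) = \<psi> z" "AE z in lborel. \<psi> (z + (0, 1)) = \<psi> z"
  shows "AE z in lborel. \<psi> (z + lattice_point k) = \<psi> z"
proof -
  define G where "G = {t. AE z in lborel. \<psi> (z + t) = \<psi> z}"
  have add: "s + t \<in> G" if "s \<in> G" "t \<in> G" for s t
  proof -
    have "AE z in lborel. \<psi> (z + s + t) = \<psi> (z + s)" "AE z in lborel. \<psi> (z + s) = \<psi> z"
      using that AE_lborel_translate[where P = "\<lambda>z. \<psi> (z + t) = \<psi> z" and t = s] by (auto simp: G_def)
    then show ?thesis unfolding G_def by (auto simp: add.assoc elim!: eventually_elim2)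
  qed
  have minus: "- t \<in> G" if "t \<in> G" for t
  proof -
    have "AE z in lborel. \<psi> (z + - t + t) = \<psi> (z + - t)"
      using that unfolding G_def by (intro AE_lborel_translate) simp
    then show ?thesis unfolding G_def mem_Collect_eq by eventually_elim simp
  qed
  have scale: "of_int m *\<^sub>R t \<in> G" if "t \<in> G" for m :: int and t
  proof (induction m rule: int_induct[where k = 0])
    case base
    show ?case by (simp add: G_def zero_prod_def[symmetric])
  next
    case (step1 i)
    then show ?case using add[OF _ that] by (simp add: scaleR_left_distrib)
  next
    case (step2 i)
    then show ?case using add[OF _ minus[OF that]] by (simp add: scaleR_left_diff_distrib)
  qed
  have "(1, 0) \<in> G" "(0, 1) \<in> G" using assms by (auto simp: G_def)
  then have "of_int (fst k) *\<^sub>R (1, 0) + of_int (snd k) *\<^sub>R (0, 1) \<in> G"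
    by (intro add scale)
  then show ?thesis by (simp add: G_def)
qed

text \<open>Modify $\psi$ on a null set so that it becomes Borel, cut it off at its essential bound, and
extend its restriction to the unit square periodically. Almost every point has all its lattice translates outside
the exceptional null sets, as there are countably many translates; at such a point the new function
agrees with $\psi$.\<close>

lemma periodic_representative:
  assumes "\<psi> \<in> Linfty_plane" "periodic_plane \<psi>"
  obtains \<Psi> B where "\<Psi> \<in> borel_measurable borel" "\<And>z. norm (\<Psi> z) \<le> B"
    "\<And>z k. \<Psi> (z + lattice_point k) = \<Psi> z" "AE z in lborel. \<psi> z = \<Psi> z"
proof -
  have meas: "\<psi> \<in> borel_measurable (completion lborel)"
    using assms(1) by (simp add: Linfty_plane_def)
  obtain B where B: "AE z in lborel. norm (\<psi> z) \<le> B"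
    using assms(1) by (auto simp: Linfty_plane_def AE_completion_iff)
  have per: "AE z in lborel. \<psi> (z + (1, 0)) = \<psi> z" "AE z in lborel. \<psi> (z + (0, 1)) = \<psi> z"
  proof -
    have ae: "AE z in lborel. \<psi> (fst z, snd z) = \<psi> (fst z + 1, snd z) \<and> \<psi> (fst z, snd z) = \<psi> (fst z, snd z + 1)"
      using assms(2) by (simp add: periodic_plane_def AE_completion_iff split_beta')
    show "AE z in lborel. \<psi> (z + (1, 0)) = \<psi> z" "AE z in lborel. \<psi> (z + (0, 1)) = \<psi> z"
      unfolding plus_prod_def fst_conv snd_conv add_0_right
      by (rule eventually_mono[OF ae], metis prod.collapse)+
  qed
  obtain R where R: "R \<in> borel_measurable lborel" "AE z in lborel. Re (\<psi> z) = R z"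
    using completion_ex_borel_measurable_real[of "\<lambda>z. Re (\<psi> z)" lborel] meas by auto
  obtain I where I: "I \<in> borel_measurable lborel" "AE z in lborel. Im (\<psi> z) = I z"
    using completion_ex_borel_measurable_real[of "\<lambda>z. Im (\<psi> z)" lborel] meas by auto
  define \<psi>' where "\<psi>' z = (if norm (Complex (R z) (I z)) \<le> B then Complex (R z) (I z) else 0)" for z
  have [measurable]: "R \<in> borel_measurable borel" "I \<in> borel_measurable borel"
    using R(1) I(1) by auto
  have [measurable]: "\<psi>' \<in> borel_measurable borel"
    unfolding \<psi>'_def Complex_eq by measurable
  have eq': "AE z in lborel. \<psi> z = \<psi>' z"
    using R(2) I(2) B
  proof eventually_elim
    case (elim z)
    then have "Complex (R z) (I z) = \<psi> z" by (simp add: complex_eq_iff)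
    with elim show ?case by (simp add: \<psi>'_def)
  qed
  \<comment> \<open>The argument of $\psi'$ is reduced to the unit square, so that $\Psi$ is exactly periodic.\<close>
  define \<Psi> where "\<Psi> z = \<psi>' (z - lattice_point (\<lfloor>fst z\<rfloor>, \<lfloor>snd z\<rfloor>))" for z
  show ?thesis
  proof (rule that[of \<Psi> "max B 0"])
    show "\<Psi> \<in> borel_measurable borel"
    proof -
      show ?thesis unfolding \<Psi>_def fst_conv snd_conv by measurable
    qed
    show "norm (\<Psi> z) \<le> max B 0" for z
      by (auto simp: \<Psi>_def \<psi>'_def)
    show "\<Psi> (z + lattice_point k) = \<Psi> z" for z k
      by (simp add: \<Psi>_def minus_prod_def)
    have "AE z in lborel. \<forall>k. \<psi> (z + lattice_point k) = \<psi> z \<and> \<psi> (z + lattice_point k) = \<psi>' (z + lattice_point k)"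
      unfolding AE_all_countable
      using AE_lborel_lattice_periodic[OF per] AE_lborel_translate[OF eq'] by (auto elim!: eventually_elim2)
    then show "AE z in lborel. \<psi> z = \<Psi> z"
    proof eventually_elim
      case (elim z)
      have "z + lattice_point (- \<lfloor>fst z\<rfloor>, - \<lfloor>snd z\<rfloor>) = z - lattice_point (\<lfloor>fst z\<rfloor>, \<lfloor>snd z\<rfloor>)"
        by (simp add: prod_eq_iff)
      then have "\<psi>' (z - lattice_point (\<lfloor>fst z\<rfloor>, \<lfloor>snd z\<rfloor>)) = \<psi> z"
        using elim by metis
      then show ?case by (simp add: \<Psi>_def)
    qed
  qed
qed

section \<open>Sampling the bilinear operator on translates of the integers\<close>

text \<open>Unlike \<open>fourier_int\<close> this is meaningful for every absolutely summable sequence.\<close>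

definition fourier_series :: "(int \<Rightarrow> complex) \<Rightarrow> real \<Rightarrow> complex" where
  "fourier_series a \<theta> = (\<integral>k. a k * cis (- 2 * pi * real_of_int k * \<theta>) \<partial>count_space UNIV)"

abbreviation torus :: "(real \<times> real) measure" where
  "torus \<equiv> cell ({0..<1} \<times> {0..<1})"

text \<open>The operator $D_\psi$ for absolutely summable sequences, such as the samples of a Schwartz
function.\<close>

definition D_series ::
  "(real \<times> real \<Rightarrow> complex) \<Rightarrow> (int \<Rightarrow> complex) \<Rightarrow> (int \<Rightarrow> complex) \<Rightarrow> int \<Rightarrow> complex" where
  "D_series \<Psi> a b l = (\<integral>z. fourier_series a (fst z) * fourier_series b (snd z) * \<Psi> z *
      cis (2 * pi * of_int l * (fst z + snd z)) \<partial>torus)"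

lemma measurable_fourier_series [measurable]: "fourier_series a \<in> borel_measurable borel"
proof -
  interpret sigma_finite_measure "count_space (UNIV :: int set)"
    by (rule sigma_finite_measure_count_space)
  have "(\<lambda>(\<theta>, k). a k * cis (- 2 * pi * real_of_int k * \<theta>)) \<in> borel_measurable (borel \<Otimes>\<^sub>M count_space UNIV)"
    by (rule measurable_pair_countable2) simp
  then show ?thesis
    unfolding fourier_series_def by (rule borel_measurable_lebesgue_integral)
qed

lemma fourier_series_finsupp:
  assumes "a \<in> finsupp_seq" shows "fourier_series a \<theta> = fourier_int a \<theta>"
proof -
  have "{k. a k * cis (- 2 * pi * real_of_int k * \<theta>) \<noteq> 0} = {k. a k \<noteq> 0}"
    by (auto simp: cis_neq_zero)
  with assms show ?thesis
    unfolding fourier_series_def fourier_int_def finsupp_seq_def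
    by (subst lebesgue_integral_count_space_finite_support) (auto simp del: mult_eq_0_iff)
qed

lemma integral_lebesgue_eq_lborel:
  fixes F G :: "'a::euclidean_space \<Rightarrow> complex"
  assumes "F \<in> borel_measurable lebesgue" "G \<in> borel_measurable borel" "AE z in lborel. F z = G z"
  shows "(\<integral>z. F z \<partial>lebesgue) = (\<integral>z. G z \<partial>lborel)"
proof -
  have "(\<integral>z. F z \<partial>lebesgue) = (\<integral>z. G z \<partial>lebesgue)"
    using assms by (intro integral_cong_AE) (auto simp: AE_completion_iff measurable_completion)
  also have "\<dots> = (\<integral>z. G z \<partial>lborel)"
    using assms(2) by (intro integral_completion) simp
  finally show ?thesis .
qed

lemma D_op_eq_D_series:
  assumes ab: "a \<in> finsupp_seq" "b \<in> finsupp_seq"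
    and \<psi>: "\<psi> \<in> borel_measurable lebesgue" and [measurable]: "\<Psi> \<in> borel_measurable borel"
    and eq: "AE z in lborel. \<psi> z = \<Psi> z"
  shows "D_op \<psi> a b l = D_series \<Psi> a b l"
proof -
  define Q where "Q = {0..<1::real} \<times> {0..<1::real}"
  have [measurable]: "Q \<in> sets borel"
    unfolding Q_def by (simp add: borel_prod[symmetric] del: borel_prod)
  define E where "E z = fourier_series a (fst z) * fourier_series b (snd z)" for z
  define e where "e z = cis (2 * pi * of_int l * (fst z + snd z))" for z :: "real \<times> real"
  have [measurable]: "E \<in> borel_measurable borel" "e \<in> borel_measurable borel"
    unfolding E_def e_def by measurable
  have [measurable]: "E \<in> borel_measurable lebesgue" "e \<in> borel_measurable lebesgue"
    by (auto intro!: measurable_completion)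
  have "D_op \<psi> a b l = (\<integral>z. indicator Q z *\<^sub>R (E z * \<psi> z * e z) \<partial>lebesgue)"
    unfolding D_op_def set_lebesgue_integral_def
    by (simp add: Q_def E_def e_def split_beta' fourier_series_finsupp ab)
  also have "\<dots> = (\<integral>z. indicator Q z *\<^sub>R (E z * \<Psi> z * e z) \<partial>lborel)"
  proof (rule integral_lebesgue_eq_lborel)
    have "(\<lambda>z. indicator Q z) \<in> borel_measurable lebesgue" by (intro borel_measurable_indicator) auto
    then show "(\<lambda>z. indicator Q z *\<^sub>R (E z * \<psi> z * e z)) \<in> borel_measurable lebesgue"
      using \<psi> by measurable
  qed (use eq in \<open>auto elim!: eventually_mono\<close>)
  also have "\<dots> = D_series \<Psi> a b l"
    unfolding D_series_def by (subst integral_restrict_space) (auto simp: Q_def[symmetric] E_def e_def)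
  finally show ?thesis .
qed

lemma fourier_series_shift:
  "(\<integral>k. f (y + real_of_int l + real_of_int k) * cis (- 2 * pi * real_of_int k * \<theta>) \<partial>count_space UNIV)
   = cis (2 * pi * real_of_int l * \<theta>) * fourier_series (\<lambda>j. f (y + real_of_int j)) \<theta>"
proof -
  have "bij_betw (\<lambda>k. l + k) UNIV (UNIV :: int set)"
    by (rule bij_betw_byWitness[where f' = "\<lambda>k. k - l"]) auto
  then have "fourier_series (\<lambda>j. f (y + real_of_int j)) \<theta>
      = (\<integral>k. f (y + real_of_int (l + k)) * cis (- 2 * pi * real_of_int (l + k) * \<theta>) \<partial>count_space UNIV)"
    unfolding fourier_series_def
    by (rule integral_bij_count_space[symmetric])
  then have "cis (2 * pi * real_of_int l * \<theta>) * fourier_series (\<lambda>j. f (y + real_of_int j)) \<theta>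
      = (\<integral>k. cis (2 * pi * real_of_int l * \<theta>) * (f (y + real_of_int (l + k)) * cis (- 2 * pi * real_of_int (l + k) * \<theta>)) \<partial>count_space UNIV)"
    by simp
  also have "\<dots> = (\<integral>k. f (y + real_of_int l + real_of_int k) * cis (- 2 * pi * real_of_int k * \<theta>) \<partial>count_space UNIV)"
  proof (rule Bochner_Integration.integral_cong[OF refl])
    fix k
    have "cis (2 * pi * real_of_int l * \<theta>) * cis (- 2 * pi * real_of_int (l + k) * \<theta>) = cis (- 2 * pi * real_of_int k * \<theta>)"
      by (simp add: cis_mult algebra_simps)
    then have "cis (2 * pi * real_of_int l * \<theta>) * (w * cis (- 2 * pi * real_of_int (l + k) * \<theta>)) = w * cis (- 2 * pi * real_of_int k * \<theta>)" for w
      by (metis mult.left_commute)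
    then show "cis (2 * pi * real_of_int l * \<theta>) * (f (y + real_of_int (l + k)) * cis (- 2 * pi * real_of_int (l + k) * \<theta>))
        = f (y + real_of_int l + real_of_int k) * cis (- 2 * pi * real_of_int k * \<theta>)"
      by (simp add: add.assoc)
  qed
  finally show ?thesis by simp
qed

lemma C_op_eq_lborel:
  assumes fg: "f \<in> schwartz" "g \<in> schwartz"
    and \<psi>: "\<psi> \<in> borel_measurable lebesgue" and [measurable]: "\<Psi> \<in> borel_measurable borel"
    and eq: "AE z in lborel. \<psi> z = \<Psi> z"
  shows "C_op \<psi> f g x = (\<integral>z. fourier_real f (fst z) * fourier_real g (snd z) * \<Psi> z *
    cis (2 * pi * x * (fst z + snd z)) \<partial>lborel)"
proof -
  have [measurable]: "fourier_real f \<in> borel_measurable borel" "fourier_real g \<in> borel_measurable borel"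
    using fg by (auto intro: measurable_fourier_real schwartz_measurable)
  define E where "E z = fourier_real f (fst z) * fourier_real g (snd z)" for z
  define e where "e z = cis (2 * pi * x * (fst z + snd z))" for z :: "real \<times> real"
  have [measurable]: "E \<in> borel_measurable borel" "e \<in> borel_measurable borel"
    unfolding E_def e_def by measurable
  have [measurable]: "E \<in> borel_measurable lebesgue" "e \<in> borel_measurable lebesgue"
    by (auto intro!: measurable_completion)
  have "C_op \<psi> f g x = (\<integral>z. E z * \<psi> z * e z \<partial>lebesgue)"
    unfolding C_op_def by (simp add: E_def e_def split_beta')
  also have "\<dots> = (\<integral>z. E z * \<Psi> z * e z \<partial>lborel)"
    by (rule integral_lebesgue_eq_lborel) (use \<psi> eq in \<open>auto elim!: eventually_mono\<close>)
  finally show ?thesis by (simp add: E_def e_def)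
qed

text \<open>The heart of the proof. Folding the plane to the torus and using the periodicity of the symbol
leaves, at each point $(\theta,\rho)$, a product of two series in $m$ and $n$; each of them is evaluated by the
Poisson summation formula.\<close>

lemma C_op_eq_D_series:
  assumes fg: "f \<in> schwartz" "g \<in> schwartz"
    and \<psi>: "\<psi> \<in> borel_measurable lebesgue" and [measurable]: "\<Psi> \<in> borel_measurable borel"
    and eq: "AE z in lborel. \<psi> z = \<Psi> z"
    and bound: "\<And>z. norm (\<Psi> z) \<le> B" and per: "\<And>z k. \<Psi> (z + lattice_point k) = \<Psi> z"
  shows "C_op \<psi> f g (y + real_of_int l)
       = D_series \<Psi> (\<lambda>j. f (y + real_of_int j)) (\<lambda>j. g (y + real_of_int j)) l"
proof -
  define x where "x = y + real_of_int l"
  have [measurable]: "fourier_real f \<in> borel_measurable borel" "fourier_real g \<in> borel_measurable borel"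
    using fg by (auto intro: measurable_fourier_real schwartz_measurable)
  have dec: "quadratic_decay (fourier_real f)" "quadratic_decay (fourier_real g)"
    using fg by (auto intro: schwartz_fourier_quadratic_decay)
  define F where "F z = fourier_real f (fst z) * fourier_real g (snd z) * \<Psi> z * cis (2 * pi * x * (fst z + snd z))" for z
  have [measurable]: "F \<in> borel_measurable borel" unfolding F_def by measurable
  have "integrable lborel (\<lambda>z. fourier_real f (fst z) * fourier_real g (snd z))"
    using dec by (subst lborel_prod[symmetric])
      (intro integrable_product lborel_pair.pair_sigma_finite_axioms quadratic_decay_integrable, auto)
  then have "integrable lborel (\<lambda>z. B * norm (fourier_real f (fst z) * fourier_real g (snd z)))"
    by (intro integrable_mult_right integrable_norm)
  then have "integrable lborel F"
  proof (rule Bochner_Integration.integrable_bound)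
    have le: "norm (F z) \<le> B * norm (fourier_real f (fst z) * fourier_real g (snd z))" for z
      unfolding F_def using mult_left_mono[OF bound[of z], of "norm (fourier_real f (fst z) * fourier_real g (snd z))"]
      by (simp add: norm_mult mult_ac)
    then show "AE z in lborel. norm (F z) \<le> norm (B * norm (fourier_real f (fst z) * fourier_real g (snd z)))"
      unfolding real_norm_def by (intro AE_I2 order_trans[OF le abs_ge_self])
  qed simp
  then have "(\<integral>z. F z \<partial>lborel) = (\<integral>z. \<integral>k. F (z + lattice_point k) \<partial>count_space UNIV \<partial>torus)"
    by (rule integral_tiling[OF tiling_plane[of 0 0, simplified]])
  also have "\<dots> = D_series \<Psi> (\<lambda>j. f (y + real_of_int j)) (\<lambda>j. g (y + real_of_int j)) l"
    unfolding D_series_def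
  proof (rule Bochner_Integration.integral_cong[OF refl])
    fix z :: "real \<times> real"
    obtain \<theta> \<rho> where z: "z = (\<theta>, \<rho>)" by (cases z)
    \<comment> \<open>The folded integrand splits into a factor in \<open>m\<close> and a factor in \<open>n\<close>.\<close>
    define u where "u m = fourier_real f (\<theta> + real_of_int m) * cis (2 * pi * x * (\<theta> + real_of_int m))" for m
    define v where "v n = fourier_real g (\<rho> + real_of_int n) * cis (2 * pi * x * (\<rho> + real_of_int n))" for n
    have int: "integrable (count_space UNIV) u" "integrable (count_space UNIV) v"
      unfolding u_def v_def
      by (rule quadratic_decay_integrable_int[OF quadratic_decay_mult_cis[OF dec(1)]] quadratic_decay_integrable_int[OF quadratic_decay_mult_cis[OF dec(2)]])+
    have "F (z + lattice_point k) = \<Psi> z * (u (fst k) * v (snd k))" for k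
    proof -
      have "cis (2 * pi * x * ((\<theta> + real_of_int (fst k)) + (\<rho> + real_of_int (snd k))))
          = cis (2 * pi * x * (\<theta> + real_of_int (fst k))) * cis (2 * pi * x * (\<rho> + real_of_int (snd k)))"
        by (simp add: cis_mult algebra_simps)
      then show ?thesis
        using per[of z k] by (simp add: F_def u_def v_def z mult_ac)
    qed
    then have "(\<integral>k. F (z + lattice_point k) \<partial>count_space UNIV)
        = \<Psi> z * ((\<integral>m. u m \<partial>count_space UNIV) * (\<integral>n. v n \<partial>count_space UNIV))"
      using integral_count_space_product[OF int] by simp
    also have "(\<integral>m. u m \<partial>count_space UNIV) = cis (2 * pi * real_of_int l * \<theta>) * fourier_series (\<lambda>j. f (y + real_of_int j)) \<theta>"
      unfolding u_def poisson_summation[OF fg(1)] x_def by (rule fourier_series_shift)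
    also have "(\<integral>n. v n \<partial>count_space UNIV) = cis (2 * pi * real_of_int l * \<rho>) * fourier_series (\<lambda>j. g (y + real_of_int j)) \<rho>"
      unfolding v_def poisson_summation[OF fg(2)] x_def by (rule fourier_series_shift)
    also have "\<Psi> z * (cis (2 * pi * real_of_int l * \<theta>) * fourier_series (\<lambda>j. f (y + real_of_int j)) \<theta> *
          (cis (2 * pi * real_of_int l * \<rho>) * fourier_series (\<lambda>j. g (y + real_of_int j)) \<rho>))
        = fourier_series (\<lambda>j. f (y + real_of_int j)) (fst z) * fourier_series (\<lambda>j. g (y + real_of_int j)) (snd z) * \<Psi> z *
          cis (2 * pi * real_of_int l * (fst z + snd z))"
      by (simp add: z distrib_left cis_mult[symmetric] mult_ac)
    finally show "(\<integral>k. F (z + lattice_point k) \<partial>count_space UNIV) = \<dots>" .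
  qed
  finally show ?thesis
    unfolding x_def[symmetric] C_op_eq_lborel[OF fg \<psi> \<open>\<Psi> \<in> borel_measurable borel\<close> eq] F_def .
qed

lemma measurable_C_op:
  assumes fg: "f \<in> schwartz" "g \<in> schwartz"
    and \<psi>: "\<psi> \<in> borel_measurable lebesgue" and [measurable]: "\<Psi> \<in> borel_measurable borel"
    and eq: "AE z in lborel. \<psi> z = \<Psi> z"
  shows "C_op \<psi> f g \<in> borel_measurable borel"
proof -
  have [measurable]: "fourier_real f \<in> borel_measurable borel" "fourier_real g \<in> borel_measurable borel"
    using fg by (auto intro: measurable_fourier_real schwartz_measurable)
  show ?thesis
    unfolding C_op_eq_lborel[OF fg \<psi> \<open>\<Psi> \<in> borel_measurable borel\<close> eq, abs_def]
    by (rule lborel.borel_measurable_lebesgue_integral) measurable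
qed

section \<open>From the integers to the real line\<close>

definition truncate :: "nat \<Rightarrow> (int \<Rightarrow> complex) \<Rightarrow> int \<Rightarrow> complex" where
  "truncate N a k = (if \<bar>k\<bar> \<le> int N then a k else 0)"

lemma truncate_finsupp: "truncate N a \<in> finsupp_seq"
proof -
  have "{k. truncate N a k \<noteq> 0} \<subseteq> {- int N..int N}" by (auto simp: truncate_def split: if_splits)
  then show ?thesis unfolding finsupp_seq_def by (auto intro: finite_subset)
qed

lemma truncate_tendsto: "(\<lambda>N. truncate N a k) \<longlonglongrightarrow> a k"
proof (intro tendsto_eventually eventually_mono[OF eventually_ge_at_top])
  fix N assume "nat \<bar>k\<bar> \<le> N"
  then show "truncate N a k = a k" by (simp add: truncate_def)
qed

lemma norm_truncate_le: "norm (truncate N a k) \<le> norm (a k)"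
  by (simp add: truncate_def)

lemma fourier_series_truncate_tendsto:
  assumes "integrable (count_space UNIV) a"
  shows "(\<lambda>N. fourier_series (truncate N a) \<theta>) \<longlonglongrightarrow> fourier_series a \<theta>"
  unfolding fourier_series_def
proof (rule integral_dominated_convergence[where w = "\<lambda>k. norm (a k)"])
  show "integrable (count_space UNIV) (\<lambda>k. norm (a k))" using assms by simp
  show "AE k in count_space UNIV. (\<lambda>N. truncate N a k * cis (- 2 * pi * real_of_int k * \<theta>))
      \<longlonglongrightarrow> a k * cis (- 2 * pi * real_of_int k * \<theta>)"
    by (intro AE_I2 tendsto_intros truncate_tendsto)
qed (auto simp: norm_mult norm_truncate_le)

lemma norm_fourier_series_le: "norm (fourier_series a \<theta>) \<le> (\<integral>k. norm (a k) \<partial>count_space UNIV)"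
  unfolding fourier_series_def by (rule order.trans[OF integral_norm_bound]) (simp add: norm_mult)

lemma norm_fourier_series_truncate_le:
  assumes "integrable (count_space UNIV) a"
  shows "norm (fourier_series (truncate N a) \<theta>) \<le> (\<integral>k. norm (a k) \<partial>count_space UNIV)"
proof (rule order.trans[OF norm_fourier_series_le Bochner_Integration.integral_mono])
  have "integrable (count_space UNIV) (truncate N a)"
    by (rule Bochner_Integration.integrable_bound[OF assms]) (auto simp: norm_truncate_le)
  then show "integrable (count_space UNIV) (\<lambda>k. norm (truncate N a k))" by simp
qed (use assms norm_truncate_le in auto)

lemma finite_measure_torus: "finite_measure torus"
proof (rule finite_measureI)
  have "emeasure lborel ({0..<1} \<times> {0..<1} :: (real \<times> real) set) = emeasure (lborel \<Otimes>\<^sub>M lborel) ({0..<1::real} \<times> {0..<1::real})"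
    by (simp add: lborel_prod)
  also have "\<dots> = 1" by (subst lborel.emeasure_pair_measure_Times) auto
  finally show "emeasure torus (space torus) \<noteq> \<infinity>"
    using tiling_plane[of 0 0] by (simp add: emeasure_restrict_space space_restrict_space tiling_def)
qed

lemma D_series_truncate_tendsto:
  assumes a: "integrable (count_space UNIV) a" and b: "integrable (count_space UNIV) b"
    and [measurable]: "\<Psi> \<in> borel_measurable borel" and bound: "\<And>z. norm (\<Psi> z) \<le> B"
  shows "(\<lambda>N. D_series \<Psi> (truncate N a) (truncate N b) l) \<longlonglongrightarrow> D_series \<Psi> a b l"
  unfolding D_series_def
proof (rule integral_dominated_convergence)
  interpret finite_measure torus by (rule finite_measure_torus)
  let ?A = "\<integral>k. norm (a k) \<partial>count_space UNIV" and ?B = "\<integral>k. norm (b k) \<partial>count_space UNIV"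
  show "integrable torus (\<lambda>_. ?A * ?B * B)" by simp
  show "(\<lambda>z. fourier_series a (fst z) * fourier_series b (snd z) * \<Psi> z * cis (2 * pi * of_int l * (fst z + snd z)))
      \<in> borel_measurable torus"
    by (rule measurable_restrict_space1) measurable
  show "(\<lambda>z. fourier_series (truncate N a) (fst z) * fourier_series (truncate N b) (snd z) * \<Psi> z *
      cis (2 * pi * of_int l * (fst z + snd z))) \<in> borel_measurable torus" for N
    by (rule measurable_restrict_space1) measurable
  show "AE z in torus. (\<lambda>N. fourier_series (truncate N a) (fst z) * fourier_series (truncate N b) (snd z) * \<Psi> z *
      cis (2 * pi * of_int l * (fst z + snd z))) \<longlonglongrightarrow>
      fourier_series a (fst z) * fourier_series b (snd z) * \<Psi> z * cis (2 * pi * of_int l * (fst z + snd z))"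
    by (intro AE_I2 tendsto_intros fourier_series_truncate_tendsto a b)
  show "AE z in torus. norm (fourier_series (truncate N a) (fst z) * fourier_series (truncate N b) (snd z) * \<Psi> z *
      cis (2 * pi * of_int l * (fst z + snd z))) \<le> ?A * ?B * B" for N
    unfolding norm_mult norm_cis mult_1_right
    by (intro AE_I2 mult_mono bound norm_fourier_series_truncate_le a b mult_nonneg_nonneg norm_ge_zero
        Bochner_Integration.integral_nonneg)
qed

text \<open>Truncation does not increase the norms on the right-hand side, and the operator converges
pointwise under truncation, so the bound survives in the limit.\<close>

lemma D_series_bound_extends:
  assumes pos: "p1 > 0" "p2 > 0" "p3 > 0"
    and \<Psi>: "\<Psi> \<in> borel_measurable borel" and bound: "\<And>z. norm (\<Psi> z) \<le> B"
    and mult: "\<And>a b. a \<in> finsupp_seq \<Longrightarrow> b \<in> finsupp_seq \<Longrightarrow>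
      lp_norm_int p3 (D_series \<Psi> a b) \<le> K * lp_norm_int p1 a * lp_norm_int p2 b"
    and a: "integrable (count_space UNIV) a" and b: "integrable (count_space UNIV) b"
  shows "lp_norm_int p3 (D_series \<Psi> a b) \<le> K * lp_norm_int p1 a * lp_norm_int p2 b"
proof -
  have mono: "lp_norm_int p (truncate N c) \<le> lp_norm_int p c" if "p > 0" for p N c
    unfolding Lp_norm_eq_eLp using that by (intro eLp_mono_AE) (auto simp: norm_truncate_le)
  have "lp_norm_int p3 (D_series \<Psi> (truncate N a) (truncate N b)) \<le> K * lp_norm_int p1 a * lp_norm_int p2 b" for N
    by (rule order.trans[OF mult[OF truncate_finsupp truncate_finsupp]]) (intro mult_mono mono pos order_refl; simp)
  then show ?thesis
    unfolding Lp_norm_eq_eLp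
    by (rule eLp_count_space_le_limit[OF pos(3) D_series_truncate_tendsto[OF a b \<Psi> bound]])
qed

abbreviation circle :: "real measure" where
  "circle \<equiv> cell {0..<1}"

lemma eLp_circle:
  assumes "p > 0" and [measurable]: "F \<in> borel_measurable borel"
  shows "eLp lborel p F = eLp circle p (\<lambda>y. eLp (count_space UNIV) p (\<lambda>j. F (y + real_of_int j)))"
  using eLp_tiling[OF tiling_real[of 0] assms] by simp

text \<open>The bound on the integers is applied on each coset $y + \mathbb{Z}$; integrating over $y$ and
using Hoelder's inequality on $[0,1)$ gives the bound on the line with the same constant.\<close>

lemma C_op_bound_of_D_series_bound:
  assumes pos: "p1 > 0" "p2 > 0" "p3 > 0" and rel: "1 / p1 + 1 / p2 = 1 / p3"
    and fg: "f \<in> schwartz" "g \<in> schwartz"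
    and \<psi>: "\<psi> \<in> borel_measurable lebesgue" and \<Psi>[measurable]: "\<Psi> \<in> borel_measurable borel"
    and eq: "AE z in lborel. \<psi> z = \<Psi> z"
    and bound: "\<And>z. norm (\<Psi> z) \<le> B" and per: "\<And>z k. \<Psi> (z + lattice_point k) = \<Psi> z"
    and mult: "\<And>a b. a \<in> finsupp_seq \<Longrightarrow> b \<in> finsupp_seq \<Longrightarrow>
      lp_norm_int p3 (D_series \<Psi> a b) \<le> K * lp_norm_int p1 a * lp_norm_int p2 b"
  shows "Lp_norm_real p3 (C_op \<psi> f g) \<le> K * Lp_norm_real p1 f * Lp_norm_real p2 g"
proof -
  define N where "N p h y = eLp (count_space UNIV) p (\<lambda>j. ennreal (norm (h (y + real_of_int j))))"
    for p and h :: "real \<Rightarrow> complex" and y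
  have [measurable]: "C_op \<psi> f g \<in> borel_measurable borel" "f \<in> borel_measurable borel" "g \<in> borel_measurable borel"
    using measurable_C_op[OF fg \<psi> \<Psi> eq] fg by (auto intro: schwartz_measurable)
  have N_meas: "N p h \<in> borel_measurable circle" if "p > 0" "h \<in> borel_measurable borel" for p h
    unfolding N_def[abs_def] using that
    by (intro measurable_eLp_count_space measurable_restrict_space1) auto
  have [measurable]: "N p1 f \<in> borel_measurable circle" "N p2 g \<in> borel_measurable circle"
    using pos by (auto intro: N_meas)
  have norm_N: "Lp_norm_real p h = eLp circle p (N p h)" if "p > 0" "h \<in> borel_measurable borel" for p h
    unfolding N_def[abs_def] Lp_norm_eq_eLp using that by (intro eLp_circle) auto
  have fibre: "N p3 (C_op \<psi> f g) y \<le> K * (N p1 f y * N p2 g y)" for y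
  proof -
    have "N p3 (C_op \<psi> f g) y = lp_norm_int p3 (D_series \<Psi> (\<lambda>j. f (y + real_of_int j)) (\<lambda>j. g (y + real_of_int j)))"
      unfolding N_def Lp_norm_eq_eLp C_op_eq_D_series[OF fg \<psi> \<Psi> eq bound per] ..
    also have "\<dots> \<le> K * lp_norm_int p1 (\<lambda>j. f (y + real_of_int j)) * lp_norm_int p2 (\<lambda>j. g (y + real_of_int j))"
      by (intro D_series_bound_extends[OF pos \<Psi> bound mult] quadratic_decay_integrable_int schwartz_quadratic_decay fg)
    finally show ?thesis by (simp add: N_def Lp_norm_eq_eLp mult.assoc)
  qed
  have "Lp_norm_real p3 (C_op \<psi> f g) = eLp circle p3 (N p3 (C_op \<psi> f g))"
    using pos by (intro norm_N) auto
  also have "\<dots> \<le> eLp circle p3 (\<lambda>y. K * (N p1 f y * N p2 g y))"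
    using pos fibre by (intro eLp_mono_AE N_meas AE_I2) auto
  also have "\<dots> = K * eLp circle p3 (\<lambda>y. N p1 f y * N p2 g y)"
    using pos by (intro eLp_cmult) auto
  also have "\<dots> \<le> K * (eLp circle p1 (N p1 f) * eLp circle p2 (N p2 g))"
    by (intro mult_left_mono eLp_holder pos rel) auto
  also have "\<dots> = K * Lp_norm_real p1 f * Lp_norm_real p2 g"
    using pos by (simp add: norm_N mult.assoc)
  finally show ?thesis .
qed

section \<open>Smooth bump functions\<close>

text \<open>Reduces the choice of all higher derivatives at once to a single differentiation step inside a
suitable class of functions.\<close>

lemma schwartz_closed_class:
  assumes "f \<in> S"
    and closed: "\<And>f. f \<in> S \<Longrightarrow> \<exists>f'\<in>S. \<forall>x. (f has_vector_derivative f' x) (at x)"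
    and bounded: "\<And>f k. f \<in> S \<Longrightarrow> \<exists>C. \<forall>x. \<bar>x\<bar> ^ k * norm (f x) \<le> C"
  shows "f \<in> schwartz"
proof -
  obtain d where d: "\<And>f. f \<in> S \<Longrightarrow> d f \<in> S" "\<And>f x. f \<in> S \<Longrightarrow> (f has_vector_derivative d f x) (at x)"
    using closed by metis
  have inS: "(d ^^ n) f \<in> S" for n
    by (induction n) (auto simp: assms(1) d(1))
  have "((d ^^ n) f has_vector_derivative (d ^^ Suc n) f x) (at x)" for n x
    using d(2)[OF inS[of n]] by simp
  with bounded[OF inS] show ?thesis
    unfolding schwartz_def by (intro CollectI exI[of _ "\<lambda>n. (d ^^ n) f"]) auto
qed

text \<open>For $P = 1$ this is the classical smooth function $e^{-1/x}$ on $(0,\infty)$ that vanishes to infinite order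
at $0$; the polynomial factor makes the family closed under differentiation.\<close>

definition flat :: "real poly \<Rightarrow> real \<Rightarrow> real" where
  "flat P x = (if 0 < x then poly P (1 / x) * exp (- (1 / x)) else 0)"

text \<open>Since $\frac{d}{dx}\bigl(P(1/x)\,e^{-1/x}\bigr) = x^{-2}\,(P - P')(1/x)\,e^{-1/x}$, differentiation acts on
$P$ in this way.\<close>

definition flat_deriv :: "real poly \<Rightarrow> real poly" where
  "flat_deriv P = [:0, 0, 1:] * (P - pderiv P)"

lemma poly_times_exp_tendsto_0:
  fixes P :: "real poly"
  shows "((\<lambda>u. poly P u * exp (- u)) \<longlongrightarrow> 0) at_top"
proof -
  have "((\<lambda>u. \<Sum>i\<le>degree P. coeff P i * (u ^ i / exp u)) \<longlongrightarrow> (\<Sum>i\<le>degree P. coeff P i * 0)) at_top"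
    by (intro tendsto_intros tendsto_power_div_exp_0)
  then show ?thesis
    by (simp add: poly_altdef sum_distrib_right exp_minus divide_inverse mult.assoc)
qed

text \<open>At the origin the difference quotient from the right is $u P(u) e^{-u}$ with $u = 1/h \to \infty$.\<close>

lemma flat_has_derivative: "(flat P has_real_derivative flat (flat_deriv P) x) (at x)"
proof -
  consider "x > 0" | "x < 0" | "x = 0" by linarith
  then show ?thesis
  proof cases
    case 1
    have "((\<lambda>x. poly P (1 / x) * exp (- (1 / x))) has_real_derivative
        poly (pderiv P) (1 / x) * (- 1 / x\<^sup>2) * exp (- (1 / x)) + poly P (1 / x) * (exp (- (1 / x)) * (1 / x\<^sup>2))) (at x)"
      using 1 by (auto intro!: derivative_eq_intros DERIV_chain2[OF poly_DERIV] simp: power2_eq_square)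
    moreover have "poly (pderiv P) (1 / x) * (- 1 / x\<^sup>2) * exp (- (1 / x)) + poly P (1 / x) * (exp (- (1 / x)) * (1 / x\<^sup>2))
        = flat (flat_deriv P) x"
      using 1 by (simp add: flat_def flat_deriv_def power2_eq_square algebra_simps)
    ultimately have "((\<lambda>x. poly P (1 / x) * exp (- (1 / x))) has_real_derivative flat (flat_deriv P) x) (at x)"
      by simp
    then show ?thesis
      by (rule has_field_derivative_transform_within_open[where S = "{0<..}"]) (use 1 in \<open>auto simp: flat_def\<close>)
  next
    case 2
    have "((\<lambda>_. 0) has_real_derivative flat (flat_deriv P) x) (at x)"
      using 2 by (simp add: flat_def)
    then show ?thesis
      by (rule has_field_derivative_transform_within_open[where S = "{..<0}"]) (use 2 in \<open>auto simp: flat_def\<close>)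
  next
    case 3
    have "((\<lambda>h. flat P h / h) \<longlongrightarrow> 0) (at 0)"
    proof (rule filterlim_split_at)
      show "((\<lambda>h. flat P h / h) \<longlongrightarrow> 0) (at_left 0)"
        by (rule tendsto_eventually) (auto simp: eventually_at_filter flat_def)
      have "((\<lambda>h. poly ([:0, 1:] * P) (inverse h) * exp (- inverse h)) \<longlongrightarrow> 0) (at_right 0)"
        by (rule filterlim_compose[OF poly_times_exp_tendsto_0 filterlim_inverse_at_top_right])
      then show "((\<lambda>h. flat P h / h) \<longlongrightarrow> 0) (at_right 0)"
        by (rule filterlim_cong[THEN iffD1, rotated -1])
           (auto simp: eventually_at_filter flat_def field_simps)
    qed
    with 3 show ?thesis
      by (simp add: DERIV_def flat_def[of P 0] flat_def[of "flat_deriv P" 0])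
  qed
qed

lemma flat_pos: "0 < x \<Longrightarrow> 0 < flat 1 x"
  by (simp add: flat_def)

definition flat_bump :: "complex \<Rightarrow> int \<Rightarrow> real poly \<Rightarrow> real poly \<Rightarrow> real \<Rightarrow> complex" where
  "flat_bump c k P Q x = c * of_real (flat P (x - of_int k) * flat Q (1 - (x - of_int k)))"

text \<open>A class that contains the test functions and, by the product rule, a derivative of each of its members.\<close>

inductive_set bumps :: "(real \<Rightarrow> complex) set" where
  bump: "flat_bump c k P Q \<in> bumps"
| sum: "f \<in> bumps \<Longrightarrow> g \<in> bumps \<Longrightarrow> (\<lambda>x. f x + g x) \<in> bumps"

lemma flat_bump_derivative:
  "(flat_bump c k P Q has_vector_derivative
     flat_bump c k (flat_deriv P) Q x + flat_bump (- c) k P (flat_deriv Q) x) (at x)"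
proof -
  have "((\<lambda>x. flat P (x - of_int k) * flat Q (1 - (x - of_int k))) has_real_derivative
      flat (flat_deriv P) (x - of_int k) * flat Q (1 - (x - of_int k))
      - flat P (x - of_int k) * flat (flat_deriv Q) (1 - (x - of_int k))) (at x)"
    by (auto intro!: derivative_eq_intros DERIV_chain2[OF flat_has_derivative])
  then have "((\<lambda>x. complex_of_real (flat P (x - of_int k) * flat Q (1 - (x - of_int k)))) has_vector_derivative
      complex_of_real (flat (flat_deriv P) (x - of_int k) * flat Q (1 - (x - of_int k))
      - flat P (x - of_int k) * flat (flat_deriv Q) (1 - (x - of_int k)))) (at x)"
    by (rule has_vector_derivative_of_real)
  from has_vector_derivative_mult_right[OF this, of c] show ?thesis
    unfolding flat_bump_def[abs_def] by (simp add: algebra_simps)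
qed

lemma bumps_derivative:
  "f \<in> bumps \<Longrightarrow> \<exists>f'\<in>bumps. \<forall>x. (f has_vector_derivative f' x) (at x)"
proof (induction rule: bumps.induct)
  case (bump c k P Q)
  show ?case
    using flat_bump_derivative by (intro bexI[OF _ bumps.sum[OF bumps.bump bumps.bump]]) auto
next
  case (sum f g)
  then obtain f' g' where "f' \<in> bumps" "g' \<in> bumps" "\<forall>x. (f has_vector_derivative f' x) (at x)"
    "\<forall>x. (g has_vector_derivative g' x) (at x)" by blast
  then show ?case
    by (intro bexI[OF _ bumps.sum[of f' g']]) (auto intro: has_vector_derivative_add)
qed

lemma bumps_support: "f \<in> bumps \<Longrightarrow> \<exists>R. \<forall>x. R < \<bar>x\<bar> \<longrightarrow> f x = 0"
proof (induction rule: bumps.induct)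
  case (bump c k P Q)
  show ?case
    by (intro exI[of _ "\<bar>of_int k\<bar> + 1"]) (auto simp: flat_bump_def flat_def)
next
  case (sum f g)
  then obtain R R' where "\<forall>x. R < \<bar>x\<bar> \<longrightarrow> f x = 0" "\<forall>x. R' < \<bar>x\<bar> \<longrightarrow> g x = 0" by blast
  then show ?case by (intro exI[of _ "max R R'"]) auto
qed

lemma bumps_bounded:
  assumes "f \<in> bumps" shows "\<exists>C. \<forall>x. \<bar>x\<bar> ^ k * norm (f x) \<le> C"
proof -
  obtain f' where "\<And>x. (f has_vector_derivative f' x) (at x)"
    using bumps_derivative[OF assms] by blast
  then have "continuous_on UNIV f"
    by (meson continuous_at_imp_continuous_on has_vector_derivative_continuous)
  then have cont: "continuous_on UNIV (\<lambda>x. \<bar>x\<bar> ^ k * norm (f x))"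
    by (intro continuous_intros)
  obtain R where R: "\<And>x. R < \<bar>x\<bar> \<Longrightarrow> f x = 0"
    using bumps_support[OF assms] by blast
  have "compact ((\<lambda>x. \<bar>x\<bar> ^ k * norm (f x)) ` {-\<bar>R\<bar>..\<bar>R\<bar>})"
    by (intro compact_continuous_image continuous_on_subset[OF cont]) auto
  then obtain C where C: "\<And>x. x \<in> {-\<bar>R\<bar>..\<bar>R\<bar>} \<Longrightarrow> \<bar>x\<bar> ^ k * norm (f x) \<le> C"
    by (force dest!: compact_imp_bounded simp: bounded_real abs_le_iff)
  show ?thesis
  proof (intro exI allI)
    fix x show "\<bar>x\<bar> ^ k * norm (f x) \<le> max C 0"
      using C[of x] R[of x] by (cases "x \<in> {-\<bar>R\<bar>..\<bar>R\<bar>}") (auto simp: le_max_iff_disj)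
  qed
qed

lemma bumps_schwartz: "f \<in> bumps \<Longrightarrow> f \<in> schwartz"
  by (erule schwartz_closed_class[OF _ bumps_derivative bumps_bounded])

lemma bumps_sum: "finite A \<Longrightarrow> (\<lambda>x. \<Sum>k\<in>A. flat_bump (c k) k P Q x) \<in> bumps"
proof (induction rule: finite_induct)
  case empty
  have "flat_bump 0 0 P Q \<in> bumps" by (rule bumps.bump)
  then show ?case by (simp add: flat_bump_def[abs_def])
qed (auto intro: bumps.intros)

definition unit_bump :: "real \<Rightarrow> real" where "unit_bump x = flat 1 x * flat 1 (1 - x)"

text \<open>The function $\sum_k a_k \varphi(\cdot - k)$ for the bump $\varphi$ above.\<close>

definition spread :: "(int \<Rightarrow> complex) \<Rightarrow> real \<Rightarrow> complex" where
  "spread a x = (\<Sum>k\<in>{k. a k \<noteq> 0}. flat_bump (a k) k 1 1 x)"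

lemma spread_schwartz: "a \<in> finsupp_seq \<Longrightarrow> spread a \<in> schwartz"
  unfolding spread_def[abs_def] finsupp_seq_def by (intro bumps_schwartz bumps_sum) simp

text \<open>The translates of the bump have disjoint supports, so at most one term is nonzero; at $y = 0$
both sides vanish.\<close>

lemma spread_eq:
  assumes "a \<in> finsupp_seq" "0 \<le> y" "y < 1"
  shows "spread a (y + of_int l) = a l * of_real (unit_bump y)"
proof -
  have fin: "finite {k. a k \<noteq> 0}" using assms(1) by (simp add: finsupp_seq_def)
  have zero: "flat_bump (a k) k 1 1 (y + of_int l) = (if k = l then a l * of_real (unit_bump y) else 0)" for k
  proof (cases "k = l")
    case False
    then have "k \<le> l - 1 \<or> l + 1 \<le> k" by linarith
    then have "of_int k \<le> of_int l - (1::real) \<or> of_int l + 1 \<le> (of_int k :: real)"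
      by (metis of_int_1 of_int_add of_int_diff of_int_le_iff)
    with assms(2,3) False show ?thesis by (auto simp: flat_bump_def flat_def)
  qed (simp add: flat_bump_def unit_bump_def)
  show ?thesis
    unfolding spread_def zero using fin by (auto simp: sum.delta')
qed

lemma unit_bump_pos: "0 < y \<Longrightarrow> y < 1 \<Longrightarrow> 0 < unit_bump y"
  by (simp add: unit_bump_def flat_pos)

lemma unit_bump_nonneg: "0 \<le> unit_bump y"
  by (simp add: unit_bump_def flat_def)

section \<open>From the real line to the integers\<close>

lemma unit_bump_le_1: "unit_bump y \<le> 1"
proof -
  have "flat 1 x \<le> 1" "0 \<le> flat 1 x" for x by (auto simp: flat_def)
  then show ?thesis unfolding unit_bump_def by (intro mult_le_one)
qed

lemma measurable_unit_bump [measurable]: "unit_bump \<in> borel_measurable borel"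
proof -
  have "continuous_on UNIV (flat P)" for P
    using flat_has_derivative by (meson DERIV_isCont continuous_at_imp_continuous_on)
  then have [measurable]: "flat P \<in> borel_measurable borel" for P
    by (rule borel_measurable_continuous_onI)
  show ?thesis unfolding unit_bump_def[abs_def] by measurable
qed

text \<open>The norm is positive because the bump is positive on $(0,1)$, and at most $1$ because the bump is at
most $1$ on an interval of length $1$.\<close>

lemma eLp_circle_bump_power:
  assumes "p > 0"
  shows "eLp circle p (\<lambda>y. ennreal (unit_bump y ^ n)) \<noteq> 0" "eLp circle p (\<lambda>y. ennreal (unit_bump y ^ n)) \<noteq> top"
proof -
  have meas[measurable]: "(\<lambda>y. ennreal (unit_bump y ^ n)) \<in> borel_measurable circle"
    by (rule measurable_restrict_space1) measurable
  show "eLp circle p (\<lambda>y. ennreal (unit_bump y ^ n)) \<noteq> 0"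
  proof
    assume "eLp circle p (\<lambda>y. ennreal (unit_bump y ^ n)) = 0"
    with \<open>p > 0\<close> have "AE y in circle. ennreal (unit_bump y ^ n) = 0"
      by (intro eLp_eq_0_imp_AE) auto
    then have "AE y in lborel. y \<in> {0..<1} \<longrightarrow> ennreal (unit_bump y ^ n) = 0"
      by (subst (asm) AE_restrict_space_iff) auto
    then have "AE y in lborel. y \<notin> {0<..<1::real}"
    proof eventually_elim
      case (elim y)
      have "0 < unit_bump y ^ n" if "y \<in> {0<..<1}"
        using that by (intro zero_less_power unit_bump_pos) auto
      with elim show ?case by (fastforce simp: ennreal_eq_0_iff)
    qed
    then have "emeasure lborel {0<..<1::real} = 0"
      by (subst (asm) AE_iff_measurable[where N = "{0<..<1}"]) auto
    then show False by simp
  qed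
  have "eLp circle p (\<lambda>y. ennreal (unit_bump y ^ n)) \<le> 1"
    using unit_bump_le_1 unit_bump_nonneg
    by (intro eLp_prob_le[OF assms _ meas]) (auto simp: emeasure_restrict_space space_restrict_space power_le_one)
  then show "eLp circle p (\<lambda>y. ennreal (unit_bump y ^ n)) \<noteq> top"
    by (auto simp: top_unique)
qed

text \<open>A function whose samples at $y$ are $\varphi(y)^n c$ behaves like a tensor product on
$[0,1) \times \mathbb{Z}$, so its norm factorises. The norm of \<open>c\<close> is allowed to be infinite, which is needed when
\<open>c\<close> is the sequence whose norm has yet to be bounded.\<close>

lemma eLp_periodized_product:
  fixes c :: "int \<Rightarrow> complex"
  assumes "p > 0" and [measurable]: "F \<in> borel_measurable borel"
    and eq: "\<And>y l. 0 \<le> y \<Longrightarrow> y < 1 \<Longrightarrow> F (y + real_of_int l) = c l * of_real (unit_bump y ^ n)"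
  shows "Lp_norm_real p F = lp_norm_int p c * eLp circle p (\<lambda>y. ennreal (unit_bump y ^ n))"
proof -
  have [measurable]: "(\<lambda>y. ennreal (unit_bump y ^ n)) \<in> borel_measurable circle"
    by (rule measurable_restrict_space1) measurable
  have fibre: "eLp (count_space UNIV) p (\<lambda>j. ennreal (norm (F (y + real_of_int j))))
      = lp_norm_int p c * ennreal (unit_bump y ^ n)" if "y \<in> space circle" for y
  proof -
    have "eLp (count_space UNIV) p (\<lambda>j. ennreal (norm (F (y + real_of_int j))))
        = eLp (count_space UNIV) p (\<lambda>j. ennreal (unit_bump y ^ n) * ennreal (norm (c j)))"
      using that unit_bump_nonneg[of y]
      by (simp add: space_restrict_space eq norm_mult norm_power ennreal_mult' mult.commute)
    also have "\<dots> = ennreal (unit_bump y ^ n) * lp_norm_int p c"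
      unfolding Lp_norm_eq_eLp using \<open>p > 0\<close> by (intro eLp_cmult) auto
    finally show ?thesis by (simp only: mult.commute)
  qed
  have "Lp_norm_real p F = eLp circle p (\<lambda>y. eLp (count_space UNIV) p (\<lambda>j. ennreal (norm (F (y + real_of_int j)))))"
    unfolding Lp_norm_eq_eLp using \<open>p > 0\<close> by (intro eLp_circle) auto
  also have "\<dots> = eLp circle p (\<lambda>y. lp_norm_int p c * ennreal (unit_bump y ^ n))"
    using \<open>p > 0\<close> fibre
    by (intro antisym eLp_mono_AE AE_I2 measurable_eLp_count_space)
       (auto intro!: measurable_restrict_space1)
  also have "\<dots> = lp_norm_int p c * eLp circle p (\<lambda>y. ennreal (unit_bump y ^ n))"
    using \<open>p > 0\<close> by (intro eLp_cmult) auto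
  finally show ?thesis .
qed

lemma D_series_scale:
  "D_series \<Psi> (\<lambda>j. a j * s) (\<lambda>j. b j * s) l = D_series \<Psi> a b l * s ^ 2"
proof -
  have scale: "fourier_series (\<lambda>j. c j * s) \<theta> = fourier_series c \<theta> * s" for c \<theta>
    unfolding fourier_series_def
    by (subst integral_mult_left_zero[symmetric]) (simp add: mult_ac)
  show ?thesis
    unfolding D_series_def scale
    by (subst integral_mult_left_zero[symmetric]) (simp add: power2_eq_square mult_ac)
qed

text \<open>Test the bound on the line with bumps. The samples of $C_\psi$ are
$\varphi(y)^2 D_\psi(a,b)$, and the norms of $\varphi$ and $\varphi^2$ can be divided out.\<close>

lemma D_series_bound_of_C_op_bound:
  assumes pos: "p1 > 0" "p2 > 0" "p3 > 0" and "K < top"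
    and \<psi>: "\<psi> \<in> borel_measurable lebesgue" and \<Psi>[measurable]: "\<Psi> \<in> borel_measurable borel"
    and eq: "AE z in lborel. \<psi> z = \<Psi> z"
    and bound: "\<And>z. norm (\<Psi> z) \<le> B" and per: "\<And>z k. \<Psi> (z + lattice_point k) = \<Psi> z"
    and mult: "\<And>f g. f \<in> schwartz \<Longrightarrow> g \<in> schwartz \<Longrightarrow>
      Lp_norm_real p3 (C_op \<psi> f g) \<le> K * Lp_norm_real p1 f * Lp_norm_real p2 g"
  shows "\<exists>c<top. \<forall>a\<in>finsupp_seq. \<forall>b\<in>finsupp_seq.
      lp_norm_int p3 (D_series \<Psi> a b) \<le> c * lp_norm_int p1 a * lp_norm_int p2 b"
proof -
  define \<kappa> where "\<kappa> p n = eLp circle p (\<lambda>y. ennreal (unit_bump y ^ n))" for p n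
  have \<kappa>: "\<kappa> p n \<noteq> 0" "\<kappa> p n < top" if "p > 0" for p n
    using eLp_circle_bump_power[OF that, of n] by (auto simp: \<kappa>_def less_top)
  show ?thesis
  proof (intro exI conjI ballI)
    show "K * \<kappa> p1 1 * \<kappa> p2 1 / \<kappa> p3 2 < top"
      using \<kappa>[OF pos(1), of 1] \<kappa>[OF pos(2), of 1] \<kappa>[OF pos(3), of 2] \<open>K < top\<close>
      by (simp add: ennreal_mult_less_top ennreal_divide_eq_top_iff less_top[symmetric] ennreal_mult_eq_top_iff)
    fix a b assume ab: "a \<in> finsupp_seq" "b \<in> finsupp_seq"
    note S = spread_schwartz[OF ab(1)] spread_schwartz[OF ab(2)]
    have spread_norm: "Lp_norm_real p (spread c) = lp_norm_int p c * \<kappa> p 1"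
      if "p > 0" "c \<in> finsupp_seq" for p c
      unfolding \<kappa>_def using that
      by (intro eLp_periodized_product) (auto simp: spread_eq intro: schwartz_measurable spread_schwartz)
    have "C_op \<psi> (spread a) (spread b) (y + real_of_int l) = D_series \<Psi> a b l * of_real (unit_bump y ^ 2)"
      if "0 \<le> y" "y < 1" for y l
      unfolding C_op_eq_D_series[OF S \<psi> \<Psi> eq bound per]
      using that ab by (simp add: spread_eq D_series_scale)
    then have "lp_norm_int p3 (D_series \<Psi> a b) * \<kappa> p3 2 = Lp_norm_real p3 (C_op \<psi> (spread a) (spread b))"
      unfolding \<kappa>_def by (intro eLp_periodized_product[symmetric] pos measurable_C_op[OF S \<psi> \<Psi> eq])
    also have "\<dots> \<le> K * Lp_norm_real p1 (spread a) * Lp_norm_real p2 (spread b)"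
      by (rule mult[OF S])
    also have "\<dots> = K * \<kappa> p1 1 * \<kappa> p2 1 * lp_norm_int p1 a * lp_norm_int p2 b"
      using pos ab by (simp add: spread_norm mult_ac)
    finally have "lp_norm_int p3 (D_series \<Psi> a b) * \<kappa> p3 2 / \<kappa> p3 2
        \<le> K * \<kappa> p1 1 * \<kappa> p2 1 * lp_norm_int p1 a * lp_norm_int p2 b / \<kappa> p3 2"
      by (rule divide_right_mono_ennreal)
    also have "lp_norm_int p3 (D_series \<Psi> a b) * \<kappa> p3 2 / \<kappa> p3 2 = lp_norm_int p3 (D_series \<Psi> a b)"
      using \<kappa>[OF pos(3), of 2] by (simp add: ennreal_mult_divide_eq)
    finally show "lp_norm_int p3 (D_series \<Psi> a b)
        \<le> K * \<kappa> p1 1 * \<kappa> p2 1 / \<kappa> p3 2 * lp_norm_int p1 a * lp_norm_int p2 b"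
      by (simp add: divide_ennreal_def mult_ac)
  qed
qed

theorem theorem3p1:
  fixes p1 p2 p3 :: ennreal and \<psi> :: "real \<times> real \<Rightarrow> complex"
  assumes "holder_related p1 p2 p3"
    and "\<psi> \<in> Linfty_plane"
    and "periodic_plane \<psi>"
  shows "\<psi> \<in> multipliers_real p1 p2 p3 \<longleftrightarrow> \<psi> \<in> multipliers_int p1 p2 p3"
proof -
  have rel: "1 / p1 + 1 / p2 = 1 / p3" and pos: "p1 > 0" "p2 > 0" "p3 > 0"
  proof -
    have "(0::ennreal) < 1" "(0::ennreal) < 1 / 2"
      by (simp_all add: ennreal_zero_less_divide)
    from less_le_trans[OF this(1)] less_le_trans[OF this(2)] assms(1) show "1 / p1 + 1 / p2 = 1 / p3" "p1 > 0" "p2 > 0" "p3 > 0"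
      unfolding holder_related_def by blast+
  qed
  have \<psi>: "\<psi> \<in> borel_measurable lebesgue" using assms(2) by (simp add: Linfty_plane_def)
  obtain \<Psi> B where \<Psi>: "\<Psi> \<in> borel_measurable borel" and bound: "\<And>z. norm (\<Psi> z) \<le> B"
    and per: "\<And>z k. \<Psi> (z + lattice_point k) = \<Psi> z" and eq: "AE z in lborel. \<psi> z = \<Psi> z"
    by (rule periodic_representative[OF assms(2,3)]) blast
  have D: "D_op \<psi> a b = D_series \<Psi> a b" if "a \<in> finsupp_seq" "b \<in> finsupp_seq" for a b
    using D_op_eq_D_series[OF that \<psi> \<Psi> eq] by blast
  show ?thesis
  proof
    assume "\<psi> \<in> multipliers_real p1 p2 p3"
    then obtain c where c: "\<And>f g. f \<in> schwartz \<Longrightarrow> g \<in> schwartz \<Longrightarrow>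
        Lp_norm_real p3 (C_op \<psi> f g) \<le> ennreal c * Lp_norm_real p1 f * Lp_norm_real p2 g"
      by (auto simp: multipliers_real_def)
    obtain c' where "c' < top" "\<And>a b. a \<in> finsupp_seq \<Longrightarrow> b \<in> finsupp_seq \<Longrightarrow>
        lp_norm_int p3 (D_series \<Psi> a b) \<le> c' * lp_norm_int p1 a * lp_norm_int p2 b"
      using D_series_bound_of_C_op_bound[OF pos ennreal_less_top \<psi> \<Psi> eq bound per c] by blast
    then have "\<And>a b. a \<in> finsupp_seq \<Longrightarrow> b \<in> finsupp_seq \<Longrightarrow>
        lp_norm_int p3 (D_op \<psi> a b) \<le> ennreal (enn2real c') * lp_norm_int p1 a * lp_norm_int p2 b"
      by (simp add: D)
    with assms(2,3) show "\<psi> \<in> multipliers_int p1 p2 p3"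
      unfolding multipliers_int_def by blast
  next
    assume "\<psi> \<in> multipliers_int p1 p2 p3"
    then obtain c where "\<And>a b. a \<in> finsupp_seq \<Longrightarrow> b \<in> finsupp_seq \<Longrightarrow>
        lp_norm_int p3 (D_series \<Psi> a b) \<le> ennreal c * lp_norm_int p1 a * lp_norm_int p2 b"
      unfolding multipliers_int_def by (auto simp flip: D)
    then have "\<And>f g. f \<in> schwartz \<Longrightarrow> g \<in> schwartz \<Longrightarrow>
        Lp_norm_real p3 (C_op \<psi> f g) \<le> ennreal c * Lp_norm_real p1 f * Lp_norm_real p2 g"
      by (intro C_op_bound_of_D_series_bound[OF pos rel _ _ \<psi> \<Psi> eq bound per])
    with assms(2) show "\<psi> \<in> multipliers_real p1 p2 p3"
      unfolding multipliers_real_def by blast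
  qed
qed

end
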